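(* There exists a smooth two-parameter family of nonflat Riemannian metrics $\{g_{\lambda,s}:\lambda>1,\ 0\le s<1\}$ on $\mathbb{T}^3$ such that $$\|r_{a,b,c}\|_{\mathrm{st},g_{\lambda,s}}=\sqrt{a^2+b^2+c^2}$$ for every $(a,b,c)\in\mathbb{R}^3\cong H_2(\mathbb{T}^3,\mathbb{R})$; thus every $g_{\lambda,s}$ has exactly the codimension-one stable norm of the unit cubic flat torus. Moreover, the metrics $g_{\lambda,s}$ are pairwise non-isometric for $(\lambda,s)\in(1,\infty)\times[0,1)$.
   Context: $\mathbb{T}^3=\mathbb{R}^3/\mathbb{Z}^3$ with coordinates $(x,y,t)$, oriented by $dx\wedge dy\wedge dt$. For $(a,b,c)\in\mathbb{R}^3$, $r_{a,b,c}\in H_2(\mathbb{T}^3,\mathbb{R})$ is the class whose Poincar\'e dual is $a[dx]+b[dy]+c[dt]$. The unit cubic flat torus is $\mathbb{R}^3/\mathbb{Z}^3$ with the Euclidean metric. Stable norm: for $r\in H_2(\mathbb{T}^3,\mathbb{R})$, $\|r\|_{\mathrm{st},g}:=\inf\{\mathbf{M}_g(T): T \text{ a closed real } 2\text{-current with } [T]=r\}$, where $\mathbf{M}_g$ is mass (equivalently, one may use real Lipschitz cycles). *)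

theory Defs
  imports "HOL-Analysis.Analysis"
begin

unbundle no cross3_syntax

text \<open>
  Tensor fields on the torus \<open>R^3/Z^3\<close> are represented by their components, with respect to the
  global frame given by the coordinates \<open>(x,y,t)\<close>, as \<open>Z^3\<close>-periodic functions on
  \<^typ>\<open>real^3\<close>.  A 1-form has the components of \<open>dx, dy, dt\<close>, a 2-form the components of
  \<open>dy \<and> dt, dt \<and> dx, dx \<and> dy\<close> (in this order), a 3-form the component of \<open>dx \<and> dy \<and> dt\<close>.
\<close>

subsection \<open>Smooth functions\<close>

definition partial :: "'a::euclidean_space \<Rightarrow> ('a \<Rightarrow> 'b::real_normed_vector) \<Rightarrow> 'a \<Rightarrow> 'b" where
  "partial v f = (\<lambda>x. frechet_derivative f (at x) v)"

primrec iter_partial :: "'a::euclidean_space list \<Rightarrow> ('a \<Rightarrow> 'b::real_normed_vector) \<Rightarrow> 'a \<Rightarrow> 'b" where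
  "iter_partial [] f = f"
| "iter_partial (v # vs) f = partial v (iter_partial vs f)"

text \<open>For an open set \<open>U\<close>: all iterated partial derivatives exist and are differentiable on \<open>U\<close>.\<close>

definition smooth_on_open :: "'a::euclidean_space set \<Rightarrow> ('a \<Rightarrow> 'b::real_normed_vector) \<Rightarrow> bool" where
  "smooth_on_open U f \<longleftrightarrow>
     (\<forall>vs. set vs \<subseteq> Basis \<longrightarrow> (\<forall>x\<in>U. iter_partial vs f differentiable (at x)))"

text \<open>Smoothness on an arbitrary set (such as one containing part of its boundary) means that
  locally there is a smooth extension to an open set.\<close>

definition smooth_on :: "'a::euclidean_space set \<Rightarrow> ('a \<Rightarrow> 'b::real_normed_vector) \<Rightarrow> bool" where
  "smooth_on S f \<longleftrightarrow>
     (\<forall>p\<in>S. \<exists>U F. open U \<and> p \<in> U \<and> smooth_on_open U F \<and> (\<forall>q\<in>U \<inter> S. F q = f q))"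

subsection \<open>The torus, Riemannian metrics, isometries\<close>

definition lattice3 :: "(real^3) set" where
  "lattice3 = {n. \<forall>i. n $ i \<in> \<int>}"

definition periodic :: "(real^3 \<Rightarrow> 'b) \<Rightarrow> bool" where
  "periodic f \<longleftrightarrow> (\<forall>x. \<forall>n\<in>lattice3. f (x + n) = f x)"

definition riemannian_metric :: "(real^3 \<Rightarrow> real^3^3) \<Rightarrow> bool" where
  "riemannian_metric g \<longleftrightarrow> periodic g \<and> smooth_on_open UNIV g \<and>
     (\<forall>x. transpose (g x) = g x) \<and> (\<forall>x v. v \<noteq> 0 \<longrightarrow> v \<bullet> (g x *v v) > 0)"

definition flat_metric :: "real^3 \<Rightarrow> real^3^3" where
  "flat_metric = (\<lambda>x. mat 1)"

text \<open>A self-diffeomorphism of the torus is given by a lift \<open>\<Phi>\<close> to the universal cover, and its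
  inverse by a lift \<open>\<Psi>\<close>; the two lifts need only be inverse to each other modulo \<open>Z^3\<close>.  No
  condition on orientation or on the induced map in homology is imposed.\<close>

definition torus_map_lift :: "(real^3 \<Rightarrow> real^3) \<Rightarrow> bool" where
  "torus_map_lift \<Phi> \<longleftrightarrow> smooth_on_open UNIV \<Phi> \<and> (\<forall>x. \<forall>n\<in>lattice3. \<Phi> (x + n) - \<Phi> x \<in> lattice3)"

definition isometric :: "(real^3 \<Rightarrow> real^3^3) \<Rightarrow> (real^3 \<Rightarrow> real^3^3) \<Rightarrow> bool" where
  "isometric g h \<longleftrightarrow> (\<exists>\<Phi> \<Psi>. torus_map_lift \<Phi> \<and> torus_map_lift \<Psi> \<and>
     (\<forall>x. \<Psi> (\<Phi> x) - x \<in> lattice3) \<and> (\<forall>x. \<Phi> (\<Psi> x) - x \<in> lattice3) \<and>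
     (\<forall>x u v. partial u \<Phi> x \<bullet> (h (\<Phi> x) *v partial v \<Phi> x) = u \<bullet> (g x *v v)))"

definition christoffel :: "(real^3 \<Rightarrow> real^3^3) \<Rightarrow> 3 \<Rightarrow> 3 \<Rightarrow> 3 \<Rightarrow> real^3 \<Rightarrow> real" where
  "christoffel g l i j x = (1/2) * (\<Sum>m\<in>UNIV. matrix_inv (g x) $ l $ m *
     (partial (axis i 1) (\<lambda>y. g y $ j $ m) x + partial (axis j 1) (\<lambda>y. g y $ i $ m) x
      - partial (axis m 1) (\<lambda>y. g y $ i $ j) x))"

text \<open>The component \<open>R^l_kij\<close> of the curvature, i.e. the \<open>l\<close>-th component of
  \<open>R(e_i, e_j) e_k\<close>.\<close>

definition riemann_curvature ::
  "(real^3 \<Rightarrow> real^3^3) \<Rightarrow> 3 \<Rightarrow> 3 \<Rightarrow> 3 \<Rightarrow> 3 \<Rightarrow> real^3 \<Rightarrow> real" where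
  "riemann_curvature g l k i j x =
     partial (axis i 1) (christoffel g l j k) x - partial (axis j 1) (christoffel g l i k) x
     + (\<Sum>m\<in>UNIV. christoffel g l i m x * christoffel g m j k x
                  - christoffel g l j m x * christoffel g m i k x)"

definition is_flat :: "(real^3 \<Rightarrow> real^3^3) \<Rightarrow> bool" where
  "is_flat g \<longleftrightarrow> (\<forall>l k i j x. riemann_curvature g l k i j x = 0)"

subsection \<open>Differential forms, currents, homology\<close>

definition smooth_form :: "(real^3 \<Rightarrow> 'b::real_normed_vector) \<Rightarrow> bool" where
  "smooth_form \<omega> \<longleftrightarrow> periodic \<omega> \<and> smooth_on_open UNIV \<omega>"

text \<open>The exterior derivatives on 1-forms and on 2-forms.\<close>

definition ext_d1 :: "(real^3 \<Rightarrow> real^3) \<Rightarrow> real^3 \<Rightarrow> real^3" where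
  "ext_d1 \<eta> x = (let D = (\<lambda>i j. partial (axis i 1) (\<lambda>y. \<eta> y $ j) x)
     in vector [D 2 3 - D 3 2, D 3 1 - D 1 3, D 1 2 - D 2 1])"

definition ext_d2 :: "(real^3 \<Rightarrow> real^3) \<Rightarrow> real^3 \<Rightarrow> real" where
  "ext_d2 \<omega> x = (\<Sum>i\<in>UNIV. partial (axis i 1) (\<lambda>y. \<omega> y $ i) x)"

text \<open>Currents are the continuous linear functionals on smooth forms, for the Frechet topology
  defined by the (increasing) sequence of \<open>C^N\<close> norms.  Values of \<open>T\<close> outside the smooth forms
  are irrelevant.\<close>

definition current :: "((real^3 \<Rightarrow> 'b::real_normed_vector) \<Rightarrow> real) \<Rightarrow> bool" where
  "current T \<longleftrightarrow>
     (\<forall>\<omega> \<eta>. smooth_form \<omega> \<longrightarrow> smooth_form \<eta> \<longrightarrow> T (\<lambda>x. \<omega> x + \<eta> x) = T \<omega> + T \<eta>) \<and>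
     (\<forall>c \<omega>. smooth_form \<omega> \<longrightarrow> T (\<lambda>x. c *\<^sub>R \<omega> x) = c * T \<omega>) \<and>
     (\<exists>N C. \<forall>\<omega> M. smooth_form \<omega> \<longrightarrow>
        (\<forall>vs x. set vs \<subseteq> Basis \<longrightarrow> length vs \<le> N \<longrightarrow> norm (iter_partial vs \<omega> x) \<le> M) \<longrightarrow>
        \<bar>T \<omega>\<bar> \<le> C * M)"

text \<open>The boundary of a current is \<open>(\<partial>T)(\<omega>) = T(d\<omega>)\<close>; a 2-current is closed if its boundary
  vanishes, and two 2-currents are homologous if they differ by the boundary of a 3-current.\<close>

definition closed_2current :: "((real^3 \<Rightarrow> real^3) \<Rightarrow> real) \<Rightarrow> bool" where
  "closed_2current T \<longleftrightarrow> current T \<and> (\<forall>\<eta>. smooth_form \<eta> \<longrightarrow> T (ext_d1 \<eta>) = 0)"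

definition homologous :: "((real^3 \<Rightarrow> real^3) \<Rightarrow> real) \<Rightarrow> ((real^3 \<Rightarrow> real^3) \<Rightarrow> real) \<Rightarrow> bool" where
  "homologous T T' \<longleftrightarrow>
     (\<exists>S. current S \<and> (\<forall>\<omega>. smooth_form \<omega> \<longrightarrow> T \<omega> - T' \<omega> = S (ext_d2 \<omega>)))"

definition homology_class ::
  "((real^3 \<Rightarrow> real^3) \<Rightarrow> real) \<Rightarrow> ((real^3 \<Rightarrow> real^3) \<Rightarrow> real) set" where
  "homology_class T = {T'. closed_2current T' \<and> homologous T' T}"

text \<open>The 2-current \<open>\<omega> \<mapsto> \<integral> \<theta> \<and> \<omega>\<close> of a 1-form \<open>\<theta>\<close>.  If \<open>\<theta>\<close> is closed, then its homology class is
  Poincare dual to the cohomology class of \<open>\<theta>\<close>; the order of \<open>\<theta>\<close> and \<open>\<omega>\<close> does not matter since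
  \<open>\<omega>\<close> has even degree.\<close>

definition wedge_current :: "(real^3 \<Rightarrow> real^3) \<Rightarrow> (real^3 \<Rightarrow> real^3) \<Rightarrow> real" where
  "wedge_current \<theta> \<omega> = integral (cbox 0 1) (\<lambda>x. \<theta> x \<bullet> \<omega> x)"

definition r_class :: "real \<Rightarrow> real \<Rightarrow> real \<Rightarrow> ((real^3 \<Rightarrow> real^3) \<Rightarrow> real) set" where
  "r_class a b c = homology_class (wedge_current (\<lambda>x. vector [a, b, c]))"

subsection \<open>Comass, mass, stable norm\<close>

text \<open>The comass of a 2-covector \<open>w\<close> at \<open>x\<close> is the supremum of \<open>w(u,v)\<close> over the simple bivectors
  \<open>u \<and> v\<close> of \<open>g\<close>-norm at most 1.  The components of \<open>u \<and> v\<close> dual to those of a 2-form are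
  those of the cross product of \<open>u\<close> and \<open>v\<close>.\<close>

definition bivector_norm_sq :: "real^3^3 \<Rightarrow> real^3 \<Rightarrow> real^3 \<Rightarrow> real" where
  "bivector_norm_sq A u v = (u \<bullet> (A *v u)) * (v \<bullet> (A *v v)) - (u \<bullet> (A *v v))\<^sup>2"

definition comass :: "(real^3 \<Rightarrow> real^3^3) \<Rightarrow> real^3 \<Rightarrow> real^3 \<Rightarrow> real" where
  "comass g x w = Sup {w \<bullet> cross3 u v | u v. bivector_norm_sq (g x) u v \<le> 1}"

definition mass :: "(real^3 \<Rightarrow> real^3^3) \<Rightarrow> ((real^3 \<Rightarrow> real^3) \<Rightarrow> real) \<Rightarrow> ereal" where
  "mass g T = (SUP \<omega>\<in>{\<omega>. smooth_form \<omega> \<and> (\<forall>x. comass g x (\<omega> x) \<le> 1)}. ereal (T \<omega>))"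

definition stable_norm ::
  "(real^3 \<Rightarrow> real^3^3) \<Rightarrow> ((real^3 \<Rightarrow> real^3) \<Rightarrow> real) set \<Rightarrow> ereal" where
  "stable_norm g r = (INF T\<in>{T. closed_2current T \<and> homology_class T = r}. mass g T)"

end

theory Submission
  imports Defs
begin

text \<open>
  Write \<open>H\<close> for the adjugate of a metric \<open>g\<close>. The mass of the current of a closed 1-form \<open>\<theta>\<close> is the
  integral of the square root of \<open>\<theta> \<bullet> H \<theta>\<close>, and a 2-form has comass at most 1 when its norm for the
  inverse of \<open>H\<close> is at most 1. For a block metric \<open>A(t) + \<rho>(t)\<^sup>2 dt\<^sup>2\<close>, where \<open>A(t)\<close> is a scalar product of
  determinant 1 on the \<open>(x,y)\<close>-plane and \<open>q\<^sub>t\<close> is the inverse form, this gives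
  \<open>\<theta> \<bullet> H \<theta> = \<rho>\<^sup>2 q\<^sub>t(a,b) + f\<^sup>2\<close> for \<open>\<theta> = (a,b,f)\<close>. Put \<open>w(t) = \<rho>(t) sqrt (q\<^sub>t(a,b))\<close>. If the mean of \<open>w\<close> is
  the Euclidean length \<open>r\<close> of \<open>(a,b)\<close>, then \<open>f = c w / r\<close> has mean \<open>c\<close> and the resulting form has mass
  \<open>sqrt (r\<^sup>2 + c\<^sup>2)\<close>. Its normalised dual \<open>H \<theta> / sqrt (\<theta> \<bullet> H \<theta>)\<close> is closed, because its first two
  components depend on \<open>t\<close> only and its third component is constant; so it is a calibration, and no
  homologous current has smaller mass. Hence the stable norm is Euclidean as soon as the norms
  \<open>sqrt q\<^sub>t\<close>, averaged with weight \<open>\<rho>\<close>, give the Euclidean norm of the plane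
  (\<open>stable_norm_polar\<close>, \<open>stable_norm_screw\<close>).

  A rotating ellipse has this averaging property. Here the ellipse of \<open>A(t)\<close> turns by the angle
  \<open>2\<pi>t\<close>. A half turn maps an ellipse to itself, so every position is taken twice in a period, at \<open>t\<close>
  and at \<open>t + 1/2\<close>. Only the sum \<open>\<rho>(t) + \<rho>(t + 1/2)\<close> enters the average, and odd harmonics cancel in
  it. The weight \<open>\<rho> = k (1 + \<alpha> cos (2\<pi>t) + \<beta> sin (2\<pi>t))\<close> therefore has the same average for all
  \<open>\<alpha>\<close> and \<open>\<beta>\<close> (\<open>integral_width\<close>); these two numbers are the parameters of the family, while the shape of
  the ellipse is fixed. A curvature component that is a product of first derivatives of the metric
  shows that the metrics are not flat (\<open>not_flat\<close>).

  The parameters are recovered from lengths of curves. Every non-contractible loop is at least as long as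
  the Euclidean unit vectors of the plane in the direction where \<open>A(t)\<close> is smallest, and equality forces
  the loop to run along a coordinate direction in a plane \<open>t = k/4\<close> (\<open>short_loop_plane\<close>). An isometry permutes
  these planes and preserves distances between them. The distances between consecutive planes are the
  integrals of \<open>\<rho>\<close> over the four quarters of the period, and the smallest and the largest distance
  from such a plane to its nearest neighbour determine \<open>\<alpha> + \<beta>\<close> and \<open>\<beta> - \<alpha>\<close> (\<open>invariants\<close>).
\<close>

section \<open>Elementary functions are smooth\<close>

lemma partial_eq: "(f has_derivative D) (at x) \<Longrightarrow> partial v f x = D v"
  unfolding partial_def by (metis frechet_derivative_at)

text \<open>
  Equality of functions near a point also matters where they are not differentiable, because the
  Frechet derivative is then an arbitrary choice; the choice depends only on the set of derivatives.
\<close>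
lemma partial_cong_open:
  assumes "open U" "x \<in> U" "\<And>y. y \<in> U \<Longrightarrow> f y = g y"
  shows "partial v f x = partial v g x"
proof -
  have "(f has_derivative D) (at x) \<longleftrightarrow> (g has_derivative D) (at x)" for D
    using assms has_derivative_transform_within_open[of f D x UNIV U g]
      has_derivative_transform_within_open[of g D x UNIV U f] by (auto simp: eq_commute)
  then show ?thesis
    unfolding partial_def frechet_derivative_def by simp
qed

lemma differentiable_cong_open:
  assumes "open U" "x \<in> U" "\<And>y. y \<in> U \<Longrightarrow> f y = g y" "g differentiable (at x)"
  shows "f differentiable (at x)"
  using assms has_derivative_transform_within_open[of g _ x UNIV U f]
  unfolding differentiable_def by fastforce

text \<open>
  A class of functions that is closed under partial derivatives by its syntax: every derivative of a
  member is again built from the listed operations. Smoothness in the sense of iterated partial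
  derivatives thus follows for all members at once, without a separate closure proof for each operation.
\<close>
inductive elementary :: "'a::euclidean_space set \<Rightarrow> ('a \<Rightarrow> real) \<Rightarrow> bool" for U where
  el_const: "elementary U (\<lambda>x. k)"
| el_linear: "bounded_linear f \<Longrightarrow> elementary U f"
| el_add: "elementary U f \<Longrightarrow> elementary U g \<Longrightarrow> elementary U (\<lambda>x. f x + g x)"
| el_mult: "elementary U f \<Longrightarrow> elementary U g \<Longrightarrow> elementary U (\<lambda>x. f x * g x)"
| el_sin: "elementary U f \<Longrightarrow> elementary U (\<lambda>x. sin (f x))"
| el_cos: "elementary U f \<Longrightarrow> elementary U (\<lambda>x. cos (f x))"
| el_sqrt: "elementary U f \<Longrightarrow> (\<And>x. x \<in> U \<Longrightarrow> f x > 0) \<Longrightarrow> elementary U (\<lambda>x. sqrt (f x))"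
| el_inverse: "elementary U f \<Longrightarrow> (\<And>x. x \<in> U \<Longrightarrow> f x \<noteq> 0) \<Longrightarrow> elementary U (\<lambda>x. inverse (f x))"

lemma el_uminus: "elementary U f \<Longrightarrow> elementary U (\<lambda>x. - f x)"
  using el_mult[OF el_const[of U "-1"]] by fastforce

lemma el_diff: "elementary U f \<Longrightarrow> elementary U g \<Longrightarrow> elementary U (\<lambda>x. f x - g x)"
  using el_add[OF _ el_uminus] by fastforce

lemma el_divide:
  "elementary U f \<Longrightarrow> elementary U g \<Longrightarrow> (\<And>x. x \<in> U \<Longrightarrow> g x \<noteq> 0) \<Longrightarrow> elementary U (\<lambda>x. f x / g x)"
  unfolding divide_inverse by (intro el_mult el_inverse)

lemma el_power2: "elementary U f \<Longrightarrow> elementary U (\<lambda>x. (f x)\<^sup>2)"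
  unfolding power2_eq_square by (intro el_mult)

lemma elementary_derivative:
  assumes "elementary U f"
  shows "\<exists>f'. (\<forall>x\<in>U. (f has_derivative f' x) (at x)) \<and> (\<forall>b. elementary U (\<lambda>x. f' x b))"
  using assms
proof induction
  case (el_const k)
  show ?case
    by (rule exI[of _ "\<lambda>x b. 0"]) (auto intro: elementary.el_const)
next
  case (el_linear f)
  then show ?case
    by (intro exI[of _ "\<lambda>x. f"]) (auto intro: elementary.el_const bounded_linear_imp_has_derivative)
next
  case (el_add f g)
  then obtain f' g' where
    "\<forall>x\<in>U. (f has_derivative f' x) (at x)" "\<forall>b. elementary U (\<lambda>x. f' x b)"
    "\<forall>x\<in>U. (g has_derivative g' x) (at x)" "\<forall>b. elementary U (\<lambda>x. g' x b)" by blast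
  then show ?case
    by (intro exI[of _ "\<lambda>x b. f' x b + g' x b"]) (auto intro!: elementary.el_add has_derivative_add)
next
  case (el_mult f g)
  then obtain f' g' where
    "\<forall>x\<in>U. (f has_derivative f' x) (at x)" "\<forall>b. elementary U (\<lambda>x. f' x b)"
    "\<forall>x\<in>U. (g has_derivative g' x) (at x)" "\<forall>b. elementary U (\<lambda>x. g' x b)" by blast
  then show ?case using el_mult.hyps
    by (intro exI[of _ "\<lambda>x b. f x * g' x b + f' x b * g x"])
       (auto intro!: elementary.el_add elementary.el_mult has_derivative_mult)
next
  case (el_sin f)
  then obtain f' where
    "\<forall>x\<in>U. (f has_derivative f' x) (at x)" "\<forall>b. elementary U (\<lambda>x. f' x b)" by blast
  then show ?case using el_sin.hyps
    by (intro exI[of _ "\<lambda>x b. f' x b * cos (f x)"])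
       (auto intro!: elementary.el_mult elementary.el_cos has_derivative_sin)
next
  case (el_cos f)
  then obtain f' where
    "\<forall>x\<in>U. (f has_derivative f' x) (at x)" "\<forall>b. elementary U (\<lambda>x. f' x b)" by blast
  then show ?case using el_cos.hyps
    by (intro exI[of _ "\<lambda>x b. f' x b * - sin (f x)"])
       (auto intro!: elementary.el_mult el_uminus elementary.el_sin
         simp del: mult_minus_right intro: has_derivative_eq_rhs[OF has_derivative_cos])
next
  case (el_sqrt f)
  then obtain f' where
    f': "\<forall>x\<in>U. (f has_derivative f' x) (at x)" "\<forall>b. elementary U (\<lambda>x. f' x b)" by blast
  have "((\<lambda>x. sqrt (f x)) has_derivative (\<lambda>b. f' x b * (inverse (sqrt (f x)) * (1/2)))) (at x)"
    if "x \<in> U" for x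
  proof -
    have "((\<lambda>x. sqrt (f x)) has_derivative (\<lambda>b. f' x b * (inverse (sqrt (f x)) / 2))) (at x)"
      using has_derivative_compose[OF bspec[OF f'(1) that]
          has_field_derivative_imp_has_derivative[OF DERIV_real_sqrt[OF el_sqrt.hyps(2)[OF that]]]]
      by (simp add: mult.commute)
    then show ?thesis by simp
  qed
  moreover have "elementary U (\<lambda>x. f' x b * (inverse (sqrt (f x)) * (1/2)))" for b
    using el_sqrt.hyps f'(2)
    by (intro elementary.el_mult elementary.el_inverse elementary.el_sqrt elementary.el_const)
       (auto simp: less_imp_neq[symmetric])
  ultimately show ?case by (intro exI[of _ "\<lambda>x b. f' x b * (inverse (sqrt (f x)) * (1/2))"]) blast
next
  case (el_inverse f)
  then obtain f' where
    f': "\<forall>x\<in>U. (f has_derivative f' x) (at x)" "\<forall>b. elementary U (\<lambda>x. f' x b)" by blast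
  then show ?case using el_inverse.hyps
    by (intro exI[of _ "\<lambda>x b. - (inverse (f x) * f' x b * inverse (f x))"])
       (auto intro!: elementary.el_mult el_uminus elementary.el_inverse has_derivative_inverse)
qed

lemma elementary_iter_partial:
  assumes "open U" "elementary U f"
  shows "\<exists>g. elementary U g \<and> (\<forall>x\<in>U. iter_partial vs f x = g x)"
proof (induction vs)
  case Nil
  then show ?case using assms by auto
next
  case (Cons v vs)
  then obtain g where g: "elementary U g" "\<forall>x\<in>U. iter_partial vs f x = g x" by blast
  from elementary_derivative[OF g(1)] obtain g' where
    g': "\<forall>x\<in>U. (g has_derivative g' x) (at x)" "\<forall>b. elementary U (\<lambda>x. g' x b)" by blast
  have "iter_partial (v # vs) f x = g' x v" if "x \<in> U" for x
    using partial_cong_open[OF \<open>open U\<close> that, of "iter_partial vs f" g v] g(2) g'(1) that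
    by (simp add: partial_eq)
  then show ?case using g' by blast
qed

lemma elementary_differentiable: "elementary U f \<Longrightarrow> x \<in> U \<Longrightarrow> f differentiable (at x)"
  using elementary_derivative differentiable_def by blast

lemma elementary_imp_smooth:
  assumes "open U" "elementary U f"
  shows "smooth_on_open U f"
  unfolding smooth_on_open_def
proof (intro allI impI ballI)
  fix vs x assume "x \<in> U"
  obtain g where g: "elementary U g" "\<forall>x\<in>U. iter_partial vs f x = g x"
    using elementary_iter_partial[OF assms] by blast
  then show "iter_partial vs f differentiable (at x)"
    using differentiable_cong_open[OF \<open>open U\<close> \<open>x \<in> U\<close>] elementary_differentiable \<open>x \<in> U\<close> by metis
qed

lemma has_derivative_vecI:
  fixes f :: "'a::real_normed_vector \<Rightarrow> 'b::real_normed_vector ^ 'n"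
  assumes "\<And>i. ((\<lambda>x. f x $ i) has_derivative (\<lambda>v. D v $ i)) (at x)"
  shows "(f has_derivative D) (at x)"
proof -
  have lin: "bounded_linear D"
  proof (rule bounded_linear_intro[where K = "\<Sum>i\<in>UNIV. onorm (\<lambda>v. D v $ i)"])
    fix x y r
    have bl: "bounded_linear (\<lambda>v. D v $ i)" for i
      by (rule has_derivative_bounded_linear[OF assms])
    show "D (x + y) = D x + D y"
      using linear_simps(1)[OF bl] by (simp add: vec_eq_iff)
    show "D (r *\<^sub>R x) = r *\<^sub>R D x"
      using linear_simps(5)[OF bl] by (simp add: vec_eq_iff)
    have "norm (D x) \<le> (\<Sum>i\<in>UNIV. norm (D x $ i))"
      by (simp add: norm_vec_def L2_set_le_sum)
    also have "\<dots> \<le> (\<Sum>i\<in>UNIV. onorm (\<lambda>v. D v $ i) * norm x)"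
      by (intro sum_mono onorm has_derivative_bounded_linear[OF assms])
    finally show "norm (D x) \<le> norm x * (\<Sum>i\<in>UNIV. onorm (\<lambda>v. D v $ i))"
      by (simp add: sum_distrib_left mult.commute)
  qed
  show ?thesis
    unfolding has_derivative_at_within
  proof (intro conjI lin vec_tendstoI)
    fix i
    show "((\<lambda>y. ((f y - f x - D (y - x)) /\<^sub>R norm (y - x)) $ i) \<longlongrightarrow> 0 $ i) (at x)"
      using assms[of i] by (simp add: has_derivative_at_within)
  qed
qed

lemma differentiable_vecI:
  fixes f :: "'a::real_normed_vector \<Rightarrow> 'b::real_normed_vector ^ 'n"
  assumes "\<And>i. (\<lambda>x. f x $ i) differentiable (at x)"
  shows "f differentiable (at x)"
proof -
  obtain D where "\<And>i. ((\<lambda>x. f x $ i) has_derivative D i) (at x)"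
    using assms unfolding differentiable_def by metis
  then have "(f has_derivative (\<lambda>v. \<chi> i. D i v)) (at x)"
    by (intro has_derivative_vecI) simp
  then show ?thesis by (auto simp: differentiable_def)
qed

lemma partial_component:
  assumes "f differentiable (at x)"
  shows "partial v (\<lambda>y. f y $ i) x = partial v f x $ i"
proof -
  obtain D where "(f has_derivative D) (at x)" using assms by (auto simp: differentiable_def)
  moreover from this have "((\<lambda>y. f y $ i) has_derivative (\<lambda>v. D v $ i)) (at x)"
    by (rule bounded_linear.has_derivative[OF bounded_linear_vec_nth])
  ultimately show ?thesis by (simp add: partial_eq)
qed

text \<open>
  The iterated partial derivatives of a vector-valued function are computed in components, so
  matrix-valued functions reduce to their scalar entries.
\<close>
lemma smooth_on_open_vecI:
  fixes f :: "'a::euclidean_space \<Rightarrow> 'b::real_normed_vector ^ 'n"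
  assumes U: "open U" and sm: "\<And>i. smooth_on_open U (\<lambda>x. f x $ i)"
  shows "smooth_on_open U f"
proof -
  have *: "(\<forall>x\<in>U. \<forall>i. iter_partial vs f x $ i = iter_partial vs (\<lambda>y. f y $ i) x)
     \<and> (\<forall>x\<in>U. iter_partial vs f differentiable (at x))" if "set vs \<subseteq> Basis" for vs
    using that
  proof (induction vs)
    case Nil
    have "f differentiable (at x)" if "x \<in> U" for x
    proof (rule differentiable_vecI)
      show "(\<lambda>x. f x $ i) differentiable (at x)" for i
        using sm[of i, unfolded smooth_on_open_def, rule_format, of "[]" x] that by simp
    qed
    then show ?case by simp
  next
    case (Cons v vs)
    then have IH: "\<And>x i. x \<in> U \<Longrightarrow> iter_partial vs f x $ i = iter_partial vs (\<lambda>y. f y $ i) x"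
      "\<And>x. x \<in> U \<Longrightarrow> iter_partial vs f differentiable (at x)" by auto
    have eq: "iter_partial (v # vs) f x $ i = iter_partial (v # vs) (\<lambda>y. f y $ i) x" if "x \<in> U" for x i
    proof -
      have "partial v (iter_partial vs f) x $ i = partial v (\<lambda>y. iter_partial vs f y $ i) x"
        by (rule partial_component[OF IH(2)[OF that], symmetric])
      also have "\<dots> = partial v (iter_partial vs (\<lambda>y. f y $ i)) x"
        by (rule partial_cong_open[OF U that IH(1)])
      finally show ?thesis by (simp only: iter_partial.simps)
    qed
    moreover have "iter_partial (v # vs) f differentiable (at x)" if "x \<in> U" for x
    proof (rule differentiable_vecI)
      fix i
      have "iter_partial (v # vs) (\<lambda>y. f y $ i) differentiable (at x)"
        using sm[of i, unfolded smooth_on_open_def, rule_format, OF Cons.prems that] .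
      then show "(\<lambda>x. iter_partial (v # vs) f x $ i) differentiable (at x)"
        by (rule differentiable_cong_open[OF U that, rotated]) (rule eq)
    qed
    ultimately show ?case by (intro conjI ballI allI)
  qed
  then show ?thesis by (auto simp: smooth_on_open_def)
qed

lemma smooth_differentiable: "smooth_on_open U f \<Longrightarrow> x \<in> U \<Longrightarrow> f differentiable (at x)"
  unfolding smooth_on_open_def by (metis empty_set empty_subsetI iter_partial.simps(1))

lemma smooth_partial_differentiable:
  "smooth_on_open U f \<Longrightarrow> x \<in> U \<Longrightarrow> b \<in> Basis \<Longrightarrow> partial b f differentiable (at x)"
  unfolding smooth_on_open_def
  by (elim allE[of _ "[b]"]) auto

section \<open>Integrals of periodic functions over the unit cube\<close>

text \<open>
  The translated cube is cut at the height where it leaves the unit cube; periodicity moves the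
  protruding slab back to the gap at the bottom.
\<close>
lemma integral_periodic_translate:
  fixes F :: "real^3 \<Rightarrow> real"
  assumes cont: "continuous_on UNIV F" and per: "\<And>x. F (x + axis i 1) = F x" and h: "0 \<le> h" "h \<le> 1"
  shows "integral (cbox 0 1) (\<lambda>x. F (x + h *\<^sub>R axis i 1)) = integral (cbox 0 1) F"
proof -
  define e :: "real^3" where "e = axis i 1"
  define b :: "real^3" where "b = (\<chi> j. if j = i then h else 1)"
  have e: "e \<in> Basis" by (simp add: e_def)
  have inn: "x \<bullet> e = x $ i" for x by (simp add: e_def inner_axis)
  have box: "cbox u v \<inter> {x. P (x \<bullet> e)} = cbox u' v' \<inter> {x. P' (x \<bullet> e)}"
    if "\<And>j. j \<noteq> i \<Longrightarrow> u $ j = u' $ j \<and> v $ j = v' $ j"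
      "\<And>y. u $ i \<le> y \<and> y \<le> v $ i \<and> P y \<longleftrightarrow> u' $ i \<le> y \<and> y \<le> v' $ i \<and> P' y"
    for u v u' v' :: "real^3" and P P'
  proof -
    have split: "x \<in> cbox r s \<longleftrightarrow> (\<forall>j. j \<noteq> i \<longrightarrow> r $ j \<le> x $ j \<and> x $ j \<le> s $ j) \<and> r $ i \<le> x $ i \<and> x $ i \<le> s $ i"
      for x r s :: "real^3"
      unfolding mem_box_cart by metis
    have "(\<forall>j. j \<noteq> i \<longrightarrow> u $ j \<le> x $ j \<and> x $ j \<le> v $ j) \<longleftrightarrow>
        (\<forall>j. j \<noteq> i \<longrightarrow> u' $ j \<le> x $ j \<and> x $ j \<le> v' $ j)" for x
      using that(1) by simp
    then have "x \<in> cbox u v \<and> P (x $ i) \<longleftrightarrow> x \<in> cbox u' v' \<and> P' (x $ i)" for x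
      unfolding split using that(2)[of "x $ i"] by blast
    then show ?thesis unfolding inn by blast
  qed
  have ints: "F integrable_on cbox u v" for u v
    by (intro integrable_continuous continuous_on_subset[OF cont]) auto
  have ei: "e $ j = (if j = i then 1 else 0)" for j by (simp add: e_def axis_def)
  have box1: "cbox (h *\<^sub>R e) (1 + h *\<^sub>R e) \<inter> {x. x \<bullet> e \<le> 1} = cbox 0 1 \<inter> {x. x \<bullet> e \<ge> h}"
    by (rule box[of _ _ _ _ "\<lambda>y. y \<le> 1" "\<lambda>y. y \<ge> h"]) (use h in \<open>auto simp: ei\<close>)
  have "cbox (h *\<^sub>R e) (1 + h *\<^sub>R e) \<inter> {x. x \<bullet> e \<ge> 1} = cbox (0 + e) (b + e) \<inter> {x. True}"
    by (rule box[of _ _ _ _ "\<lambda>y. y \<ge> 1" "\<lambda>y. True"]) (use h in \<open>auto simp: ei b_def\<close>)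
  then have box2: "cbox (h *\<^sub>R e) (1 + h *\<^sub>R e) \<inter> {x. x \<bullet> e \<ge> 1} = cbox (0 + e) (b + e)"
    by simp
  have "cbox 0 b \<inter> {x. True} = cbox 0 1 \<inter> {x. x \<bullet> e \<le> h}"
    by (rule box[of _ _ _ _ "\<lambda>y. True" "\<lambda>y. y \<le> h"]) (use h in \<open>auto simp: b_def\<close>)
  then have box3: "cbox 0 b = cbox 0 1 \<inter> {x. x \<bullet> e \<le> h}" by simp
  have shift: "integral (cbox (u + v) (w + v)) F = integral (cbox u w) (\<lambda>x. F (x + v))" for u v w
    unfolding integral_shift_cbox_plus[symmetric] by (simp add: o_def add.commute)
  have "integral (cbox 0 1) (\<lambda>x. F (x + h *\<^sub>R e)) = integral (cbox (h *\<^sub>R e) (1 + h *\<^sub>R e)) F"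
    using shift[of 0 "h *\<^sub>R e" 1] by simp
  also have "\<dots> = integral (cbox (h *\<^sub>R e) (1 + h *\<^sub>R e) \<inter> {x. x \<bullet> e \<le> 1}) F
      + integral (cbox (h *\<^sub>R e) (1 + h *\<^sub>R e) \<inter> {x. x \<bullet> e \<ge> 1}) F"
    by (rule integral_split[OF ints e])
  also have "\<dots> = integral (cbox 0 1 \<inter> {x. x \<bullet> e \<ge> h}) F + integral (cbox 0 b) F"
    unfolding box1 box2 shift using per by (simp add: e_def)
  also have "\<dots> = integral (cbox 0 1) F"
    unfolding box3 integral_split[OF ints e, of 0 1 h] by (rule add.commute)
  finally show ?thesis by (simp add: e_def)
qed

lemma line_derivative:
  assumes "F differentiable (at (x + h *\<^sub>R e))"
  shows "((\<lambda>h. F (x + h *\<^sub>R e)) has_vector_derivative partial e F (x + h *\<^sub>R e)) (at h within S)"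
proof -
  from assms obtain D where D: "(F has_derivative D) (at (x + h *\<^sub>R e))"
    by (auto simp: differentiable_def)
  have line: "((\<lambda>h. x + h *\<^sub>R e) has_derivative (\<lambda>k. k *\<^sub>R e)) (at h within S)"
    by (auto intro!: derivative_eq_intros)
  have "((\<lambda>h. F (x + h *\<^sub>R e)) has_derivative (\<lambda>k. D (k *\<^sub>R e))) (at h within S)"
    by (rule has_derivative_compose[OF line, of F D]) (rule D)
  moreover have "D (k *\<^sub>R e) = k *\<^sub>R D e" for k
    using has_derivative_bounded_linear[OF D] by (simp add: linear_simps)
  ultimately show ?thesis
    using partial_eq[OF D, of e] by (simp add: has_vector_derivative_def)
qed

text \<open>
  Integration by parts on the torus without Fubini: the integral of \<open>W(x) F(x + h e)\<close> does not depend on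
  \<open>h\<close>, so its derivative at \<open>h = 0\<close>, computed under the integral sign, vanishes.
\<close>
lemma integral_partial_zero:
  fixes F W :: "real^3 \<Rightarrow> real"
  assumes diff: "\<And>x. F differentiable (at x)"
    and cont: "continuous_on UNIV (partial (axis i 1) F)"
    and per: "\<And>x. F (x + axis i 1) = F x"
    and W: "continuous_on UNIV W" "\<And>x h. W (x + h *\<^sub>R axis i 1) = W x"
  shows "integral (cbox 0 1) (\<lambda>x. W x * partial (axis i 1) F x) = 0"
proof -
  define e :: "real^3" where "e = axis i 1"
  have Fc: "continuous_on UNIV F"
    using diff by (simp add: continuous_on_eq_continuous_at differentiable_imp_continuous_within)
  define I where "I = (\<lambda>h. integral (cbox 0 1) (\<lambda>x. W x * F (x + h *\<^sub>R e)))"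
  have I_const: "I h = I 0" if "h \<in> {0..1}" for h
  proof -
    have "I h = integral (cbox 0 1) (\<lambda>x. (\<lambda>x. W x * F x) (x + h *\<^sub>R axis i 1))"
      unfolding I_def e_def using W(2) by simp
    also have "\<dots> = integral (cbox 0 1) (\<lambda>x. W x * F x)"
      using that per W(2)[of _ 1]
      by (intro integral_periodic_translate continuous_intros Fc W) auto
    finally show ?thesis by (simp add: I_def)
  qed
  have "(I has_vector_derivative integral (cbox 0 1) (\<lambda>x. W x * partial e F (x + 0 *\<^sub>R e)))
      (at 0 within {0..1})"
    unfolding I_def
  proof (rule leibniz_rule_vector_derivative)
    fix h :: real and x :: "real^3"
    show "((\<lambda>h. W x * F (x + h *\<^sub>R e)) has_vector_derivative W x * partial e F (x + h *\<^sub>R e))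
        (at h within {0..1})"
      by (intro has_vector_derivative_mult_right line_derivative diff)
    show "(\<lambda>x. W x * F (x + h *\<^sub>R e)) integrable_on cbox 0 1"
      by (intro integrable_continuous continuous_intros continuous_on_subset[OF W(1)]
          continuous_on_compose2[OF Fc]) auto
  next
    show "continuous_on ({0..1} \<times> cbox 0 1) (\<lambda>(h, x). W x * partial e F (x + h *\<^sub>R e))"
      unfolding split_beta
      by (intro continuous_intros continuous_on_compose2[OF W(1)]
          continuous_on_compose2[OF cont, folded e_def]) auto
  qed auto
  moreover have "(I has_vector_derivative 0) (at 0 within {0..1})"
  proof (rule has_vector_derivative_transform[of 0 "{0..1}" I "\<lambda>h. I 0"])
    show "I h = I 0" if "h \<in> {0..1}" for h by (rule I_const[OF that])
  qed auto
  ultimately have "integral (cbox 0 1) (\<lambda>x. W x * partial e F (x + 0 *\<^sub>R e)) = 0"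
    by (intro vector_derivative_unique_within_closed_interval[of 0 1 0 I]) auto
  then show ?thesis by (simp add: e_def)
qed

lemma antiderivative_exists:
  fixes \<phi> :: "real \<Rightarrow> real"
  assumes "continuous_on UNIV \<phi>"
  obtains \<Phi> where "\<And>t. (\<Phi> has_real_derivative \<phi> t) (at t)"
proof -
  have ints: "\<phi> integrable_on {a..b}" for a b
    using assms continuous_on_subset by (blast intro: integrable_continuous_interval)
  \<comment> \<open>Integrals from 0, with the sign convention for negative end points.\<close>
  define G where "G = (\<lambda>t. if t \<ge> 0 then integral {0..t} \<phi> else - integral {t..0} \<phi>)"
  have "(G has_real_derivative \<phi> t) (at t)" for t
  proof -
    define N where "N = \<bar>t\<bar> + 1"
    have c: "continuous_on {-N..N} \<phi>" using assms continuous_on_subset by blast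
    have eq: "G u = integral {-N..u} \<phi> - integral {-N..0} \<phi>" if "u \<in> {-N<..<N}" for u
      using Henstock_Kurzweil_Integration.integral_combine[of "-N" 0 u \<phi>]
        Henstock_Kurzweil_Integration.integral_combine[of "-N" u 0 \<phi>] that ints
      by (auto simp: G_def N_def)
    have "((\<lambda>u. integral {-N..u} \<phi>) has_real_derivative \<phi> t) (at t within {-N..N})"
      by (rule integral_has_real_derivative[OF c]) (auto simp: N_def)
    then have "((\<lambda>u. integral {-N..u} \<phi>) has_real_derivative \<phi> t) (at t)"
      by (subst (asm) at_within_interior) (auto simp: N_def)
    then have "((\<lambda>u. integral {-N..u} \<phi> - integral {-N..0} \<phi>) has_real_derivative \<phi> t) (at t)"
      by (auto intro!: derivative_eq_intros)
    then show ?thesis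
      by (rule has_field_derivative_transform_within_open[of _ _ _ "{-N<..<N}"])
         (use eq in \<open>auto simp: N_def\<close>)
  qed
  then show ?thesis by (rule that)
qed

lemma continuous_of_deriv: "(\<And>t. (f has_real_derivative f' t) (at t)) \<Longrightarrow> continuous_on S f"
  by (meson DERIV_continuous continuous_at_imp_continuous_on)

lemma partial_layer:
  assumes "(U has_real_derivative d) (at (x $ 3))"
  shows "((\<lambda>x::real^3. U (x $ 3)) has_derivative (\<lambda>v. d * v $ 3)) (at x)"
    and "partial v (\<lambda>x::real^3. U (x $ 3)) x = d * v $ 3"
proof -
  show *: "((\<lambda>x::real^3. U (x $ 3)) has_derivative (\<lambda>v. d * v $ 3)) (at x)"
    using assms unfolding has_field_derivative_def
    by (intro has_derivative_compose[of "\<lambda>x. x $ 3" "\<lambda>v. v $ 3" x UNIV U "(*) d"]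
        bounded_linear_imp_has_derivative bounded_linear_vec_nth)
  show "partial v (\<lambda>x::real^3. U (x $ 3)) x = d * v $ 3"
    by (rule partial_eq[OF *])
qed

text \<open>
  The mean of \<open>\<phi>\<close> over the cube must agree with its one-dimensional mean \<open>L\<close>, because the antiderivative
  of \<open>\<phi> - L\<close> is periodic and its derivative has integral zero over the cube.
\<close>
lemma periodic_antiderivative:
  fixes \<phi> :: "real \<Rightarrow> real"
  assumes cont: "continuous_on UNIV \<phi>" and per: "\<And>t. \<phi> (t + 1) = \<phi> t"
    and mean: "integral (cbox 0 1) (\<lambda>x::real^3. \<phi> (x $ 3)) = K"
  obtains U where "\<And>t. (U has_real_derivative \<phi> t - K) (at t)" "\<And>t. U (t + 1) = U t"
proof -
  obtain \<Phi> where \<Phi>: "\<And>t. (\<Phi> has_real_derivative \<phi> t) (at t)"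
    using antiderivative_exists[OF cont] by blast
  define L where "L = \<Phi> 1 - \<Phi> 0"
  have "((\<lambda>t. \<Phi> (t + 1) - \<Phi> t) has_real_derivative 0) (at t)" for t
  proof -
    have "((\<lambda>t. \<Phi> (t + 1)) has_real_derivative \<phi> t) (at t)"
      using \<Phi>[of "t + 1"] per by (simp add: DERIV_shift)
    from DERIV_diff[OF this \<Phi>[of t]] show ?thesis by simp
  qed
  then have "\<Phi> (t + 1) - \<Phi> t = \<Phi> (0 + 1) - \<Phi> 0" for t
    by (intro DERIV_isconst_all) blast
  then have L: "\<Phi> (t + 1) - \<Phi> t = L" for t by (simp add: L_def)
  define U where "U = (\<lambda>t. \<Phi> t - L * t)"
  have U: "(U has_real_derivative \<phi> t - L) (at t)" for t
    unfolding U_def by (auto intro!: derivative_eq_intros \<Phi>)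
  have Uper: "U (t + 1) = U t" for t
    using L[of t] by (simp add: U_def algebra_simps)
  have pU: "partial (axis 3 1) (\<lambda>x::real^3. U (x $ 3)) = (\<lambda>x. \<phi> (x $ 3) - L)"
    by (auto simp: partial_layer(2)[OF U] axis_def)
  have c3: "continuous_on UNIV (\<lambda>x::real^3. \<phi> (x $ 3))"
    by (rule continuous_on_compose2[OF cont]) (auto intro!: continuous_intros)
  have "integral (cbox 0 1) (\<lambda>x::real^3. 1 * partial (axis 3 1) (\<lambda>x::real^3. U (x $ 3)) x) = 0"
  proof (rule integral_partial_zero)
    show "(\<lambda>x::real^3. U (x $ 3)) differentiable (at x)" for x
      using partial_layer(1)[OF U] differentiable_def by blast
    show "continuous_on UNIV (partial (axis 3 1) (\<lambda>x::real^3. U (x $ 3)))"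
      unfolding pU by (intro continuous_intros c3)
  qed (auto simp: Uper)
  then have "integral (cbox 0 1) (\<lambda>x::real^3. \<phi> (x $ 3) - L) = 0" by (simp add: pU)
  moreover have "integral (cbox 0 1) (\<lambda>x::real^3. \<phi> (x $ 3) - L)
      = integral (cbox 0 1) (\<lambda>x::real^3. \<phi> (x $ 3)) - integral (cbox 0 1) (\<lambda>x::real^3. L)"
    by (intro integral_diff integrable_continuous continuous_on_subset[OF c3]) auto
  moreover have "integral (cbox 0 1) (\<lambda>x::real^3. L) = L"
    by (simp add: content_cbox_if_cart interval_eq_empty_cart)
  ultimately have "L = K" using mean by simp
  then show ?thesis using that U Uper by blast
qed

section \<open>Currents, homology and calibrations\<close>

lemma smooth_form_continuous: "smooth_form \<omega> \<Longrightarrow> continuous_on S \<omega>"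
  unfolding smooth_form_def
  by (meson UNIV_I continuous_at_imp_continuous_on differentiable_imp_continuous_within smooth_differentiable)

lemma smooth_form_component:
  fixes \<eta> :: "real^3 \<Rightarrow> real^3"
  assumes "smooth_form \<eta>"
  shows "(\<lambda>y. \<eta> y $ j) differentiable (at x)"
    and "continuous_on S (partial (axis i 1) (\<lambda>y. \<eta> y $ j))"
    and "\<eta> (x + axis i 1) $ j = \<eta> x $ j"
    and "continuous_on S (\<lambda>x. \<eta> x $ j)"
proof -
  have d: "\<eta> differentiable (at x)" for x
    using assms smooth_differentiable by (auto simp: smooth_form_def)
  then obtain D where "(\<eta> has_derivative D) (at x)" unfolding differentiable_def by blast
  then have "((\<lambda>y. \<eta> y $ j) has_derivative (\<lambda>v. D v $ j)) (at x)"
    by (rule bounded_linear.has_derivative[OF bounded_linear_vec_nth])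
  then show "(\<lambda>y. \<eta> y $ j) differentiable (at x)"
    unfolding differentiable_def by blast
  have "partial (axis i 1) \<eta> differentiable (at x)" for x
    using assms smooth_partial_differentiable[of UNIV \<eta> x "axis i 1"]
    by (auto simp: smooth_form_def)
  then have "continuous_on S (\<lambda>x. partial (axis i 1) \<eta> x $ j)"
    by (intro continuous_intros)
       (meson continuous_at_imp_continuous_on differentiable_imp_continuous_within)
  moreover have "partial (axis i 1) (\<lambda>y. \<eta> y $ j) = (\<lambda>x. partial (axis i 1) \<eta> x $ j)"
    using partial_component[OF d] by blast
  ultimately show "continuous_on S (partial (axis i 1) (\<lambda>y. \<eta> y $ j))" by simp
  have "axis i 1 \<in> lattice3" by (auto simp: lattice3_def axis_def)
  then show "\<eta> (x + axis i 1) $ j = \<eta> x $ j"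
    using assms by (auto simp: smooth_form_def periodic_def)
  show "continuous_on S (\<lambda>x. \<eta> x $ j)"
    by (intro continuous_intros smooth_form_continuous assms)
qed

lemma integrable_cont: "continuous_on UNIV f \<Longrightarrow> f integrable_on cbox a (b::real^3)"
  for f :: "real^3 \<Rightarrow> real"
  by (intro integrable_continuous) (auto elim: continuous_on_subset)

lemma current_integral:
  fixes \<theta> :: "real^3 \<Rightarrow> 'b::euclidean_space"
  assumes cont: "continuous_on UNIV \<theta>"
  shows "current (\<lambda>\<omega>. integral (cbox 0 1) (\<lambda>x. \<theta> x \<bullet> \<omega> x))"
  unfolding current_def
proof (intro conjI allI impI)
  have c: "continuous_on UNIV (\<lambda>x. \<theta> x \<bullet> \<omega> x)" if "smooth_form \<omega>" for \<omega>
    by (intro continuous_intros cont smooth_form_continuous that)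
  fix \<omega> \<eta> :: "real^3 \<Rightarrow> 'b" and k :: real
  assume \<omega>: "smooth_form \<omega>"
  show "integral (cbox 0 1) (\<lambda>x. \<theta> x \<bullet> k *\<^sub>R \<omega> x) = k * integral (cbox 0 1) (\<lambda>x. \<theta> x \<bullet> \<omega> x)"
    by simp
  assume \<eta>: "smooth_form \<eta>"
  show "integral (cbox 0 1) (\<lambda>x. \<theta> x \<bullet> (\<omega> x + \<eta> x))
     = integral (cbox 0 1) (\<lambda>x. \<theta> x \<bullet> \<omega> x) + integral (cbox 0 1) (\<lambda>x. \<theta> x \<bullet> \<eta> x)"
    unfolding inner_add_right by (intro integral_add integrable_cont c \<omega> \<eta>)
next
  have c: "continuous_on UNIV (\<lambda>x. \<theta> x \<bullet> \<omega> x)" if "smooth_form \<omega>" for \<omega>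
    by (intro continuous_intros cont smooth_form_continuous that)
  show "\<exists>N C. \<forall>\<omega> M. smooth_form \<omega> \<longrightarrow>
        (\<forall>vs x. set vs \<subseteq> Basis \<longrightarrow> length vs \<le> N \<longrightarrow> norm (iter_partial vs \<omega> x) \<le> M) \<longrightarrow>
        \<bar>integral (cbox 0 1) (\<lambda>x. \<theta> x \<bullet> \<omega> x)\<bar> \<le> C * M"
  proof (rule exI[of _ 0], rule exI[of _ "integral (cbox 0 1) (\<lambda>x. norm (\<theta> x))"], intro allI impI)
    fix \<omega> :: "real^3 \<Rightarrow> 'b" and M
    assume \<omega>: "smooth_form \<omega>"
      and "\<forall>vs x. set vs \<subseteq> Basis \<longrightarrow> length vs \<le> 0 \<longrightarrow> norm (iter_partial vs \<omega> x) \<le> M"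
    then have M: "norm (\<omega> x) \<le> M" for x by (elim allE[of _ "[]"]) auto
    have "norm (integral (cbox 0 1) (\<lambda>x. \<theta> x \<bullet> \<omega> x)) \<le> integral (cbox 0 1) (\<lambda>x. norm (\<theta> x) * M)"
    proof (rule integral_norm_bound_integral)
      show "(\<lambda>x. norm (\<theta> x) * M) integrable_on cbox 0 1"
        by (intro integrable_cont continuous_intros cont)
      show "norm (\<theta> x \<bullet> \<omega> x) \<le> norm (\<theta> x) * M" for x
        using order_trans[OF Cauchy_Schwarz_ineq2[of "\<theta> x" "\<omega> x"]
          mult_left_mono[OF M[of x] norm_ge_zero[of "\<theta> x"]]] by simp
    qed (intro integrable_cont c \<omega>)
    then show "\<bar>integral (cbox 0 1) (\<lambda>x. \<theta> x \<bullet> \<omega> x)\<bar> \<le> integral (cbox 0 1) (\<lambda>x. norm (\<theta> x)) * M"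
      by simp
  qed
qed

lemma current_uminus: "current S \<Longrightarrow> current (\<lambda>\<omega>. - S \<omega>)"
  unfolding current_def by simp

lemma current_add:
  fixes S T :: "(real^3 \<Rightarrow> 'b::real_normed_vector) \<Rightarrow> real"
  assumes "current S" "current T"
  shows "current (\<lambda>\<omega>. S \<omega> + T \<omega>)"
  unfolding current_def
proof (intro conjI allI impI)
  fix \<omega> \<eta> :: "real^3 \<Rightarrow> 'b" and k :: real
  assume \<omega>: "smooth_form \<omega>"
  show "S (\<lambda>x. k *\<^sub>R \<omega> x) + T (\<lambda>x. k *\<^sub>R \<omega> x) = k * (S \<omega> + T \<omega>)"
    using assms \<omega> by (simp add: current_def distrib_left)
  assume \<eta>: "smooth_form \<eta>"
  show "S (\<lambda>x. \<omega> x + \<eta> x) + T (\<lambda>x. \<omega> x + \<eta> x) = S \<omega> + T \<omega> + (S \<eta> + T \<eta>)"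
    using assms \<omega> \<eta> by (simp add: current_def)
next
  from assms obtain N C N' C' where
    *: "\<And>\<omega> M. smooth_form \<omega> \<Longrightarrow>
        (\<forall>vs x. set vs \<subseteq> Basis \<longrightarrow> length vs \<le> N \<longrightarrow> norm (iter_partial vs \<omega> x) \<le> M) \<Longrightarrow>
        \<bar>S \<omega>\<bar> \<le> C * M"
       "\<And>\<omega> M. smooth_form \<omega> \<Longrightarrow>
        (\<forall>vs x. set vs \<subseteq> Basis \<longrightarrow> length vs \<le> N' \<longrightarrow> norm (iter_partial vs \<omega> x) \<le> M) \<Longrightarrow>
        \<bar>T \<omega>\<bar> \<le> C' * M"
    unfolding current_def by metis
  show "\<exists>N C. \<forall>\<omega> M. smooth_form \<omega> \<longrightarrow>
        (\<forall>vs x. set vs \<subseteq> Basis \<longrightarrow> length vs \<le> N \<longrightarrow> norm (iter_partial vs \<omega> x) \<le> M) \<longrightarrow>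
        \<bar>S \<omega> + T \<omega>\<bar> \<le> C * M"
  proof (rule exI[of _ "max N N'"], rule exI[of _ "C + C'"], intro allI impI)
    fix \<omega> :: "real^3 \<Rightarrow> 'b" and M
    assume \<omega>: "smooth_form \<omega>" and
      M: "\<forall>vs x. set vs \<subseteq> Basis \<longrightarrow> length vs \<le> max N N' \<longrightarrow> norm (iter_partial vs \<omega> x) \<le> M"
    have "\<bar>S \<omega>\<bar> \<le> C * M" "\<bar>T \<omega>\<bar> \<le> C' * M"
      using M by (auto intro!: * \<omega>)
    then show "\<bar>S \<omega> + T \<omega>\<bar> \<le> (C + C') * M" by (simp add: distrib_right)
  qed
qed

lemma homologous_refl: "homologous T T"
  unfolding homologous_def
  using current_integral[of "\<lambda>x. 0 :: real"] by (intro exI[of _ "\<lambda>\<omega>. 0"]) simp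

lemma homologous_sym: "homologous T T' \<Longrightarrow> homologous T' T"
  unfolding homologous_def by (metis current_uminus minus_diff_eq)

lemma homologous_trans:
  assumes "homologous T T'" "homologous T' T''"
  shows "homologous T T''"
proof -
  from assms obtain S S' where
    "current S" "\<forall>\<omega>. smooth_form \<omega> \<longrightarrow> T \<omega> - T' \<omega> = S (ext_d2 \<omega>)"
    "current S'" "\<forall>\<omega>. smooth_form \<omega> \<longrightarrow> T' \<omega> - T'' \<omega> = S' (ext_d2 \<omega>)"
    by (auto simp: homologous_def)
  then show ?thesis unfolding homologous_def
    by (intro exI[of _ "\<lambda>\<phi>. S \<phi> + S' \<phi>"] conjI current_add) (auto simp: algebra_simps)
qed

lemma homology_class_eqI: "homologous T T' \<Longrightarrow> homology_class T = homology_class T'"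
  unfolding homology_class_def using homologous_sym homologous_trans by blast

lemma homology_class_eq_homologous:
  "closed_2current T \<Longrightarrow> homology_class T = homology_class T' \<Longrightarrow> homologous T T'"
  unfolding homology_class_def using homologous_refl by blast

abbreviation layer_form :: "real \<Rightarrow> real \<Rightarrow> (real \<Rightarrow> real) \<Rightarrow> real^3 \<Rightarrow> real^3" where
  "layer_form a b f \<equiv> \<lambda>x. vector [a, b, f (x $ 3)]"

lemma continuous_layer:
  assumes "continuous_on UNIV f"
  shows "continuous_on UNIV (\<lambda>x::real^3. f (x $ 3) :: real)"
  by (rule continuous_on_compose2[OF assms]) (auto intro!: continuous_intros)

lemma continuous_layer_form:
  assumes "continuous_on UNIV f"
  shows "continuous_on UNIV (layer_form a b f)"
proof -
  have "layer_form a b f = (\<lambda>x. \<chi> i. if i = 1 then a else if i = 2 then b else f (x $ 3))"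
    by (auto simp: vec_eq_iff forall_3)
  moreover have "continuous_on UNIV (\<lambda>x::real^3. \<chi> i::3. if i = 1 then a else if i = 2 then b else f (x $ 3))"
  proof (rule continuous_on_vec_lambda)
    show "continuous_on UNIV (\<lambda>x::real^3. if i = 1 then a else if i = 2 then b else f (x $ 3))" for i :: 3
      using continuous_layer[OF assms] by (cases "i = 1"; cases "i = 2") (simp_all add: continuous_on_const)
  qed
  ultimately show ?thesis by (simp only:)
qed

lemma current_wedge: "continuous_on UNIV f \<Longrightarrow> current (wedge_current (layer_form a b f))"
  unfolding wedge_current_def[abs_def] by (intro current_integral continuous_layer_form)

lemma closed_layer_current:
  assumes f: "continuous_on UNIV f"
  shows "closed_2current (wedge_current (layer_form a b f))"
  unfolding closed_2current_def
proof (intro conjI allI impI current_wedge f)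
  fix \<eta> :: "real^3 \<Rightarrow> real^3"
  assume \<eta>: "smooth_form \<eta>"
  define D where "D = (\<lambda>i j. partial (axis i 1) (\<lambda>y. \<eta> y $ j))"
  have z: "((\<lambda>x. W x * D i j x) has_integral 0) (cbox 0 1)"
    if "continuous_on UNIV W" "\<And>x h. W (x + h *\<^sub>R axis i 1) = W x" for W :: "real^3 \<Rightarrow> real" and i j
  proof -
    have "integral (cbox 0 1) (\<lambda>x. W x * D i j x) = 0"
      unfolding D_def
      by (intro integral_partial_zero smooth_form_component(1,2)[OF \<eta>] that
          smooth_form_component(3)[OF \<eta>])
    moreover have "(\<lambda>x. W x * D i j x) integrable_on cbox 0 1"
      unfolding D_def by (intro integrable_cont continuous_on_mult that smooth_form_component(2)[OF \<eta>])
    ultimately show ?thesis by (simp add: has_integral_iff)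
  qed
  have f3: "continuous_on UNIV (\<lambda>x::real^3. f (x $ 3))"
    by (rule continuous_layer[OF f])
  have "layer_form a b f x \<bullet> ext_d1 \<eta> x = (a * D 2 3 x - a * D 3 2 x) + (b * D 3 1 x - b * D 1 3 x)
       + (f (x $ 3) * D 1 2 x - f (x $ 3) * D 2 1 x)" for x
    by (simp add: inner_vec_def sum_3 ext_d1_def Let_def D_def algebra_simps)
  moreover have "((\<lambda>x. (a * D 2 3 x - a * D 3 2 x) + (b * D 3 1 x - b * D 1 3 x)
       + (f (x $ 3) * D 1 2 x - f (x $ 3) * D 2 1 x)) has_integral ((0 - 0) + (0 - 0) + (0 - 0)))
       (cbox 0 1)"
    by (intro has_integral_add has_integral_diff z f3 continuous_on_const) (simp_all add: axis_def)
  ultimately show "wedge_current (layer_form a b f) (ext_d1 \<eta>) = 0"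
    by (simp add: wedge_current_def integral_unique)
qed

text \<open>
  With a periodic antiderivative \<open>U\<close> of \<open>f - c\<close>, integration by parts in the third direction exhibits the
  difference of the two currents as the boundary of the 3-current given by \<open>- U\<close>.
\<close>
lemma homologous_layer:
  assumes f: "continuous_on UNIV f"
    and U: "\<And>t. (U has_real_derivative f t - c) (at t)" "\<And>t. U (t + 1) = U t"
  shows "homologous (wedge_current (layer_form a b f)) (wedge_current (\<lambda>x. vector [a, b, c]))"
  unfolding homologous_def
proof (intro exI[of _ "\<lambda>\<phi>. - integral (cbox 0 1) (\<lambda>x::real^3. U (x $ 3) \<bullet> \<phi> x)"] conjI allI impI
    current_uminus current_integral)
  have Uc: "continuous_on UNIV (\<lambda>x::real^3. U (x $ 3))"
    by (intro continuous_layer continuous_of_deriv[OF U(1)])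
  then show "continuous_on UNIV (\<lambda>x::real^3. U (x $ 3))" .
  have fc: "continuous_on UNIV (\<lambda>x::real^3. f (x $ 3))"
    by (rule continuous_layer[OF f])
  fix \<omega> :: "real^3 \<Rightarrow> real^3"
  assume \<omega>: "smooth_form \<omega>"
  define D where "D = (\<lambda>i. partial (axis i 1) (\<lambda>y. \<omega> y $ i))"
  have Dc: "continuous_on UNIV (D i)" for i
    unfolding D_def by (rule smooth_form_component[OF \<omega>])
  have z: "integral (cbox 0 1) (\<lambda>x. U (x $ 3) * D i x) = 0" if "i \<noteq> 3" for i
    unfolding D_def using that
    by (intro integral_partial_zero smooth_form_component[OF \<omega>] Uc) (auto simp: axis_def)
  have p3: "((\<lambda>x. U (x $ 3) * \<omega> x $ 3) has_derivative
      (\<lambda>v. U (x $ 3) * D' v + (f (x $ 3) - c) * v $ 3 * \<omega> x $ 3)) (at x)"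
    if "((\<lambda>x. \<omega> x $ 3) has_derivative D') (at x)" for x D'
    by (rule has_derivative_mult[OF partial_layer(1)[OF U(1)] that])
  have p3': "partial (axis 3 1) (\<lambda>x. U (x $ 3) * \<omega> x $ 3) =
      (\<lambda>x. U (x $ 3) * D 3 x + (f (x $ 3) - c) * \<omega> x $ 3)"
  proof
    fix x
    obtain D' where D': "((\<lambda>x. \<omega> x $ 3) has_derivative D') (at x)"
      using smooth_form_component(1)[OF \<omega>] by (auto simp: differentiable_def)
    show "partial (axis 3 1) (\<lambda>x. U (x $ 3) * \<omega> x $ 3) x =
       U (x $ 3) * D 3 x + (f (x $ 3) - c) * \<omega> x $ 3"
      using partial_eq[OF p3[OF D']] partial_eq[OF D'] by (simp add: D_def axis_def)
  qed
  have "integral (cbox 0 1) (\<lambda>x. 1 * partial (axis 3 1) (\<lambda>x. U (x $ 3) * \<omega> x $ 3) x) = 0"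
  proof (rule integral_partial_zero)
    show "(\<lambda>x. U (x $ 3) * \<omega> x $ 3) differentiable (at x)" for x
      using p3 smooth_form_component(1)[OF \<omega>] unfolding differentiable_def by blast
    show "continuous_on UNIV (partial (axis 3 1) (\<lambda>x. U (x $ 3) * \<omega> x $ 3))"
      unfolding p3' by (intro continuous_intros Uc Dc fc smooth_form_component[OF \<omega>])
    show "U ((x + axis 3 1) $ 3) * \<omega> (x + axis 3 1) $ 3 = U (x $ 3) * \<omega> x $ 3" for x
      using U(2) smooth_form_component(3)[OF \<omega>] by (simp add: axis_def)
  qed auto
  then have z3: "integral (cbox 0 1) (\<lambda>x. U (x $ 3) * D 3 x) +
     integral (cbox 0 1) (\<lambda>x. (f (x $ 3) - c) * \<omega> x $ 3) = 0"
    unfolding p3'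
    by (subst integral_add[symmetric])
       (auto intro!: integrable_cont continuous_intros Uc Dc fc smooth_form_component[OF \<omega>])
  have "wedge_current (layer_form a b f) \<omega> - wedge_current (\<lambda>x. vector [a, b, c]) \<omega> =
     integral (cbox 0 1) (\<lambda>x. layer_form a b f x \<bullet> \<omega> x - vector [a, b, c] \<bullet> \<omega> x)"
    unfolding wedge_current_def
    by (intro integral_diff[symmetric] integrable_cont continuous_intros continuous_layer_form f
        smooth_form_continuous \<omega>)
  also have "\<dots> = integral (cbox 0 1) (\<lambda>x. (f (x $ 3) - c) * \<omega> x $ 3)"
    by (simp add: inner_vec_def sum_3 algebra_simps)
  also have "\<dots> = - (integral (cbox 0 1) (\<lambda>x. U (x $ 3) * D 1 x)
      + integral (cbox 0 1) (\<lambda>x. U (x $ 3) * D 2 x) + integral (cbox 0 1) (\<lambda>x. U (x $ 3) * D 3 x))"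
    using z3 z[of 1] z[of 2] by simp
  also have "\<dots> = - integral (cbox 0 1) (\<lambda>x. U (x $ 3) * D 1 x + U (x $ 3) * D 2 x + U (x $ 3) * D 3 x)"
    by (simp add: integral_add integrable_cont continuous_on_add continuous_on_mult Uc Dc)
  also have "\<dots> = - integral (cbox 0 1) (\<lambda>x. U (x $ 3) \<bullet> ext_d2 \<omega> x)"
    by (simp add: ext_d2_def sum_3 D_def algebra_simps)
  finally show "wedge_current (layer_form a b f) \<omega> - wedge_current (\<lambda>x. vector [a, b, c]) \<omega> =
    - integral (cbox 0 1) (\<lambda>x. U (x $ 3) \<bullet> ext_d2 \<omega> x)" .
qed

text \<open>
  The calibration argument: homologous currents take the same value on the closed form \<open>cal\<close>, so this
  value bounds the mass of each of them from below, while the current of the layer form attains it.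
\<close>
lemma stable_norm_eqI:
  assumes f: "continuous_on UNIV f"
    and U: "\<And>t. (U has_real_derivative f t - c) (at t)" "\<And>t. U (t + 1) = U t"
    and upper: "\<And>\<omega>. smooth_form \<omega> \<Longrightarrow> (\<And>x. comass g x (\<omega> x) \<le> 1)
      \<Longrightarrow> wedge_current (layer_form a b f) \<omega> \<le> K"
    and cal: "smooth_form cal" "\<And>x. comass g x (cal x) \<le> 1" "\<And>x. ext_d2 cal x = 0"
      "wedge_current (\<lambda>x. vector [a, b, c]) cal = K"
  shows "stable_norm g (r_class a b c) = ereal K"
proof (rule antisym)
  let ?T = "wedge_current (layer_form a b f)"
  have "homology_class ?T = r_class a b c"
    unfolding r_class_def by (intro homology_class_eqI homologous_layer[OF f U])
  then have "stable_norm g (r_class a b c) \<le> mass g ?T"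
    unfolding stable_norm_def by (intro INF_lower) (auto intro: closed_layer_current f)
  also have "mass g ?T \<le> ereal K"
    unfolding mass_def by (intro SUP_least) (auto intro: upper)
  finally show "stable_norm g (r_class a b c) \<le> ereal K" .
  show "ereal K \<le> stable_norm g (r_class a b c)"
    unfolding stable_norm_def
  proof (rule INF_greatest)
    fix T assume "T \<in> {T. closed_2current T \<and> homology_class T = r_class a b c}"
    then have "homologous T (wedge_current (\<lambda>x. vector [a, b, c]))"
      unfolding r_class_def by (auto intro: homology_class_eq_homologous)
    then obtain S where S: "current S"
      "T cal - wedge_current (\<lambda>x. vector [a, b, c]) cal = S (ext_d2 cal)"
      using cal(1) by (auto simp: homologous_def)
    have e0: "ext_d2 cal = (\<lambda>x. 0)" using cal(3) by auto
    have "smooth_form (\<lambda>x::real^3. 0::real)"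
      unfolding smooth_form_def by (auto simp: periodic_def intro!: elementary_imp_smooth el_const)
    then have "S (\<lambda>x. 0 *\<^sub>R 0) = 0 * S (\<lambda>x. 0)"
      using S(1) unfolding current_def by blast
    then have "S (ext_d2 cal) = 0" using e0 by simp
    then have "T cal = K" using S(2) cal(4) by simp
    then show "ereal K \<le> mass g T"
      unfolding mass_def by (intro SUP_upper2[of cal]) (auto intro: cal)
  qed
qed

section \<open>Screw metrics and their stable norm\<close>

lemma trig_int_period:
  assumes "n \<in> \<int>"
  shows "sin (x + 2 * pi * n) = sin x" "cos (x + 2 * pi * n) = cos x"
proof -
  obtain k where "n = of_int k" using assms by (auto elim: Ints_cases)
  then show "sin (x + 2 * pi * n) = sin x" "cos (x + 2 * pi * n) = cos x"
    by (simp_all add: sin_add cos_add)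
qed

lemma trig_int_period':
  assumes "n \<in> \<int>"
  shows "sin (4 * pi * (t + n)) = sin (4 * pi * t)" "cos (4 * pi * (t + n)) = cos (4 * pi * t)"
    "sin (2 * pi * (t + n)) = sin (2 * pi * t)" "cos (2 * pi * (t + n)) = cos (2 * pi * t)"
    "cos (4 * pi * (t + n) - a) = cos (4 * pi * t - a)"
proof -
  have "2 * n \<in> \<int>" using assms by simp
  note P = trig_int_period[OF this] trig_int_period[OF assms]
  show "sin (4 * pi * (t + n)) = sin (4 * pi * t)" "cos (4 * pi * (t + n)) = cos (4 * pi * t)"
    "sin (2 * pi * (t + n)) = sin (2 * pi * t)" "cos (2 * pi * (t + n)) = cos (2 * pi * t)"
    "cos (4 * pi * (t + n) - a) = cos (4 * pi * t - a)"
    using P(1,2)[of "4 * pi * t"] P(3,4)[of "2 * pi * t"] P(2)[of "4 * pi * t - a"]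
    by (simp_all add: algebra_simps)
qed

text \<open>
  The dual norm \<open>sqrt (q\<^sub>t(v))\<close> of the unit vector \<open>v = (cos \<phi>, sin \<phi>)\<close> of the plane.
\<close>
definition breadth :: "real \<Rightarrow> real \<Rightarrow> real \<Rightarrow> real \<Rightarrow> real" where
  "breadth C D \<phi> t = sqrt (C + D * cos (4 * pi * t - 2 * \<phi>))"

definition normalizer :: "real \<Rightarrow> real \<Rightarrow> real" where
  "normalizer C D = inverse (integral (cbox 0 1) (\<lambda>x::real^3. breadth C D 0 (x $ 3)))"

definition speed :: "real \<Rightarrow> real \<Rightarrow> real \<Rightarrow> real \<Rightarrow> real \<Rightarrow> real" where
  "speed C D \<alpha> \<beta> t = normalizer C D * (1 + \<alpha> * cos (2 * pi * t) + \<beta> * sin (2 * pi * t))"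

text \<open>
  The planar block has eigenvalues \<open>C - D\<close> and \<open>C + D\<close>, with axes turned by \<open>2\<pi>t\<close>. The matrix entries
  contain \<open>4\<pi>t\<close> because they are quadratic in the axes, which is why they have period \<open>1/2\<close>.
\<close>
definition screw_matrix :: "real \<Rightarrow> real \<Rightarrow> real \<Rightarrow> real \<Rightarrow> real \<Rightarrow> real^3^3" where
  "screw_matrix C D \<alpha> \<beta> t = vector
     [vector [C - D * cos (4 * pi * t), - (D * sin (4 * pi * t)), 0],
      vector [- (D * sin (4 * pi * t)), C + D * cos (4 * pi * t), 0],
      vector [0, 0, (speed C D \<alpha> \<beta> t)\<^sup>2]]"

definition screw_metric :: "real \<Rightarrow> real \<Rightarrow> real \<Rightarrow> real \<Rightarrow> real^3 \<Rightarrow> real^3^3" where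
  "screw_metric C D \<alpha> \<beta> = (\<lambda>x. screw_matrix C D \<alpha> \<beta> (x $ 3))"

lemma all_3I: "P 1 \<Longrightarrow> P 2 \<Longrightarrow> P 3 \<Longrightarrow> P (i::3)"
  using forall_3 by blast

lemma elementary_screw_matrix:
  assumes "elementary U a" "elementary U b" "elementary U \<tau>"
  shows "elementary U (\<lambda>p. screw_matrix C D (a p) (b p) (\<tau> p) $ i $ j)"
proof -
  have 1: "elementary U (\<lambda>p. screw_matrix C D (a p) (b p) (\<tau> p) $ 1 $ j)"
    by (rule all_3I[of _ j]; simp add: screw_matrix_def)
       (intro el_add el_diff el_mult el_cos el_sin el_uminus el_const assms)+
  have 2: "elementary U (\<lambda>p. screw_matrix C D (a p) (b p) (\<tau> p) $ 2 $ j)"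
    by (rule all_3I[of _ j]; simp add: screw_matrix_def)
       (intro el_add el_diff el_mult el_cos el_sin el_uminus el_const assms)+
  have 3: "elementary U (\<lambda>p. screw_matrix C D (a p) (b p) (\<tau> p) $ 3 $ j)"
    by (rule all_3I[of _ j]; simp add: screw_matrix_def speed_def)
       (intro el_add el_diff el_mult el_power2 el_cos el_sin el_uminus el_const assms)+
  show ?thesis by (rule all_3I[of _ i]) (rule 1 2 3)+
qed

lemma smooth_screw_matrix:
  assumes "open U" "elementary U a" "elementary U b" "elementary U \<tau>"
  shows "smooth_on_open U (\<lambda>p. screw_matrix C D (a p) (b p) (\<tau> p))"
  by (intro smooth_on_open_vecI elementary_imp_smooth elementary_screw_matrix assms)

lemma el_coord: "elementary U (\<lambda>x::real^3. x $ i)"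
  by (intro el_linear bounded_linear_vec_nth)

lemma partial_invariant_zero:
  assumes "F differentiable (at x)" "\<And>h. F (x + h *\<^sub>R e) = F x"
  shows "partial e F x = 0"
proof -
  have "((\<lambda>h. F (x + h *\<^sub>R e)) has_vector_derivative partial e F x) (at 0)"
    using line_derivative[of F x 0 e UNIV] assms(1) by simp
  moreover have "((\<lambda>h. F (x + h *\<^sub>R e)) has_vector_derivative 0) (at 0)"
    unfolding assms(2) by simp
  ultimately show ?thesis by (rule vector_derivative_unique_at)
qed

text \<open>
  Every 2-vector in dimension three is simple, so the supremum in the comass runs over all
  vectors of norm at most 1.
\<close>
lemma cross3_surj: "\<exists>u v. cross3 u v = (\<xi> :: real^3)"
proof -
  \<comment> \<open>A nonzero vector orthogonal to \<open>\<xi>\<close>.\<close>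
  define u :: "real^3" where
    "u = (if \<xi> $ 1 = 0 \<and> \<xi> $ 2 = 0 then vector [1, 0, 0] else vector [- \<xi> $ 2, \<xi> $ 1, 0])"
  have u: "u \<noteq> 0" "u \<bullet> \<xi> = 0"
    by (auto simp: u_def vec_eq_iff forall_3 inner_vec_def sum_3)
  have "cross3 u ((1 / (u \<bullet> u)) *\<^sub>R cross3 \<xi> u) = (1 / (u \<bullet> u)) *\<^sub>R cross3 u (cross3 \<xi> u)"
    by (rule cross_mult_right)
  also have "cross3 u (cross3 \<xi> u) = (u \<bullet> u) *\<^sub>R \<xi> - (u \<bullet> \<xi>) *\<^sub>R u"
    by (rule Lagrange)
  finally have "cross3 u ((1 / (u \<bullet> u)) *\<^sub>R cross3 \<xi> u) = \<xi>" using u by simp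
  then show ?thesis by blast
qed

text \<open>
  The assumptions make the planar block positive definite with determinant 1 and the weight positive. The
  case \<open>D = 0\<close>, of a circle, is included for the sake of the flat metric.
\<close>
locale screw =
  fixes C D \<alpha> \<beta> :: real
  assumes det1: "C\<^sup>2 - D\<^sup>2 = 1" and C1: "C \<ge> 1" and D0: "D \<ge> 0" and small: "\<bar>\<alpha>\<bar> + \<bar>\<beta>\<bar> < 1"
begin

abbreviation "g \<equiv> screw_metric C D \<alpha> \<beta>"
abbreviation "\<rho> \<equiv> speed C D \<alpha> \<beta>"

lemma DC: "D < C"
  using det1 C1 D0 by (smt (verit) power_mono)

lemma osc_pos: "C + D * cos a > 0" "C - D * cos a > 0"
proof -
  have "\<bar>D * cos a\<bar> \<le> D * 1" unfolding abs_mult using D0 abs_cos_le_one by (simp add: mult_left_le)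
  then show "C + D * cos a > 0" "C - D * cos a > 0" using DC by auto
qed

lemma breadth_pos: "breadth C D \<phi> t > 0"
  unfolding breadth_def using osc_pos by simp

lemma breadth_sq: "(breadth C D \<phi> t)\<^sup>2 = C + D * cos (4 * pi * t - 2 * \<phi>)"
  unfolding breadth_def using osc_pos by (simp add: less_imp_le)

lemma continuous_breadth: "continuous_on UNIV (breadth C D \<phi>)"
  unfolding breadth_def[abs_def] by (intro continuous_intros)

lemma integral_breadth_0_pos: "integral (cbox 0 1) (\<lambda>x::real^3. breadth C D 0 (x $ 3)) > 0"
proof -
  have "integral (cbox 0 1) (\<lambda>x::real^3. 0) < integral (cbox 0 1) (\<lambda>x::real^3. breadth C D 0 (x $ 3))"
  proof (rule integral_less)
    show "continuous_on (cbox 0 1) (\<lambda>x::real^3. breadth C D 0 (x $ 3))"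
      by (rule continuous_on_subset[OF continuous_layer[OF continuous_breadth]]) simp
    show "box 0 (1::real^3) \<noteq> {}" by (simp add: interval_ne_empty_cart)
  qed (auto simp: breadth_pos)
  then show ?thesis by simp
qed

lemma normalizer_pos: "normalizer C D > 0"
  unfolding normalizer_def using integral_breadth_0_pos by simp

lemma profile_pos: "1 + \<alpha> * cos a + \<beta> * sin a > 0"
proof -
  have "\<bar>\<alpha> * cos a\<bar> \<le> \<bar>\<alpha>\<bar> * 1" "\<bar>\<beta> * sin a\<bar> \<le> \<bar>\<beta>\<bar> * 1"
    unfolding abs_mult by (intro mult_left_mono; simp)+
  then show ?thesis using small by linarith
qed

lemma speed_pos: "\<rho> t > 0"
  unfolding speed_def using profile_pos normalizer_pos by (intro mult_pos_pos) auto

lemma speed_periodic: "n \<in> \<int> \<Longrightarrow> \<rho> (t + n) = \<rho> t"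
  by (simp only: speed_def trig_int_period')

lemma breadth_periodic: "n \<in> \<int> \<Longrightarrow> breadth C D \<phi> (t + n) = breadth C D \<phi> t"
  by (simp only: breadth_def trig_int_period')

lemma continuous_speed: "continuous_on UNIV \<rho>"
  unfolding speed_def[abs_def] by (intro continuous_intros)

definition width where "width \<phi> t = \<rho> t * breadth C D \<phi> t"

lemma width_pos: "width \<phi> t > 0"
  by (simp add: width_def speed_pos breadth_pos)

lemma continuous_width: "continuous_on UNIV (width \<phi>)"
  unfolding width_def[abs_def] by (intro continuous_intros continuous_speed continuous_breadth)

text \<open>
  Changing the direction \<open>\<phi>\<close> amounts to a translation in \<open>t\<close>, because the ellipse rotates uniformly.
\<close>
lemma integral_breadth:
  assumes "0 \<le> \<phi>" "\<phi> \<le> 2 * pi"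
  shows "integral (cbox 0 1) (\<lambda>x::real^3. breadth C D \<phi> (x $ 3))
       = integral (cbox 0 1) (\<lambda>x::real^3. breadth C D 0 (x $ 3))"
proof -
  \<comment> \<open>The phase in the breadth is \<open>4\<pi>(t - h)\<close>.\<close>
  define h where "h = \<phi> / (2 * pi)"
  have "integral (cbox 0 1) (\<lambda>x::real^3. breadth C D \<phi> ((x + h *\<^sub>R axis 3 1) $ 3))
      = integral (cbox 0 1) (\<lambda>x::real^3. breadth C D \<phi> (x $ 3))"
  proof (rule integral_periodic_translate)
    show "continuous_on UNIV (\<lambda>x::real^3. breadth C D \<phi> (x $ 3))"
      by (rule continuous_layer[OF continuous_breadth])
    show "breadth C D \<phi> ((x + axis 3 1) $ 3) = breadth C D \<phi> (x $ 3)" for x :: "real^3"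
      using breadth_periodic[of 1] by (simp add: axis_def)
  qed (use assms in \<open>auto simp: h_def field_simps\<close>)
  moreover have "breadth C D \<phi> ((x + h *\<^sub>R axis 3 1) $ 3) = breadth C D 0 (x $ 3)" for x :: "real^3"
    by (simp add: breadth_def axis_def h_def algebra_simps)
  ultimately show ?thesis by simp
qed

text \<open>
  The odd harmonics of the weight change sign under \<open>t \<mapsto> t + 1/2\<close>, whereas the breadth does not change;
  their contribution to the mean is therefore zero.
\<close>
lemma integral_width:
  assumes "0 \<le> \<phi>" "\<phi> \<le> 2 * pi"
  shows "integral (cbox 0 1) (\<lambda>x::real^3. width \<phi> (x $ 3)) = 1"
proof -
  define P where "P = (\<lambda>t. (\<alpha> * cos (2 * pi * t) + \<beta> * sin (2 * pi * t)) * breadth C D \<phi> t)"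
  have Pc: "continuous_on UNIV P"
    unfolding P_def by (intro continuous_intros continuous_breadth)
  have odd: "P (t + 1 / 2) = - P t" for t
  proof -
    have "breadth C D \<phi> (t + 1 / 2) = breadth C D \<phi> t"
      using trig_int_period(2)[of 1 "4 * pi * t - 2 * \<phi>"] by (simp add: breadth_def algebra_simps)
    moreover have "cos (2 * pi * (t + 1 / 2)) = - cos (2 * pi * t)"
      "sin (2 * pi * (t + 1 / 2)) = - sin (2 * pi * t)"
      by (simp_all add: distrib_left cos_add sin_add)
    ultimately show ?thesis by (simp add: P_def algebra_simps)
  qed
  have "integral (cbox 0 1) (\<lambda>x::real^3. P ((x + (1 / 2) *\<^sub>R axis 3 1) $ 3))
      = integral (cbox 0 1) (\<lambda>x::real^3. P (x $ 3))"
  proof (rule integral_periodic_translate)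
    show "continuous_on UNIV (\<lambda>x::real^3. P (x $ 3))" by (rule continuous_layer[OF Pc])
    show "P ((x + axis 3 1) $ 3) = P (x $ 3)" for x :: "real^3"
      using odd[of "x $ 3"] odd[of "x $ 3 + 1 / 2"] by (simp add: axis_def add.commute)
  qed auto
  moreover have "P ((x + (1 / 2) *\<^sub>R axis 3 1) $ 3) = - P (x $ 3)" for x :: "real^3"
    using odd by (simp add: axis_def)
  ultimately have P0: "integral (cbox 0 1) (\<lambda>x::real^3. P (x $ 3)) = 0" by simp
  have "width \<phi> t = normalizer C D * (breadth C D \<phi> t + P t)" for t
    by (simp add: width_def speed_def P_def algebra_simps)
  then have "integral (cbox 0 1) (\<lambda>x::real^3. width \<phi> (x $ 3))
      = normalizer C D * integral (cbox 0 1) (\<lambda>x::real^3. breadth C D \<phi> (x $ 3) + P (x $ 3))"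
    by simp
  also have "integral (cbox 0 1) (\<lambda>x::real^3. breadth C D \<phi> (x $ 3) + P (x $ 3))
      = integral (cbox 0 1) (\<lambda>x::real^3. breadth C D \<phi> (x $ 3))
        + integral (cbox 0 1) (\<lambda>x::real^3. P (x $ 3))"
    by (intro integral_add integrable_cont continuous_layer Pc continuous_breadth)
  finally show ?thesis
    using integral_breadth_0_pos unfolding P0 integral_breadth[OF assms] by (simp add: normalizer_def)
qed

lemma metric_form:
  "u \<bullet> (g x *v v) = (C - D * cos (4 * pi * x $ 3)) * (u $ 1 * v $ 1)
     - D * sin (4 * pi * x $ 3) * (u $ 1 * v $ 2 + u $ 2 * v $ 1)
     + (C + D * cos (4 * pi * x $ 3)) * (u $ 2 * v $ 2) + (\<rho> (x $ 3))\<^sup>2 * (u $ 3 * v $ 3)"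
  by (simp add: screw_metric_def screw_matrix_def inner_vec_def matrix_vector_mult_def sum_3 algebra_simps)

text \<open>
  The quadratic form of the adjugate of the metric, which measures bivectors by \<open>cross3\<close>.
\<close>
definition dual_form :: "real^3 \<Rightarrow> real^3 \<Rightarrow> real^3 \<Rightarrow> real" where
  "dual_form x \<xi> \<eta> = (\<rho> (x $ 3))\<^sup>2 * ((C + D * cos (4 * pi * x $ 3)) * (\<xi> $ 1 * \<eta> $ 1)
     + D * sin (4 * pi * x $ 3) * (\<xi> $ 1 * \<eta> $ 2 + \<xi> $ 2 * \<eta> $ 1)
     + (C - D * cos (4 * pi * x $ 3)) * (\<xi> $ 2 * \<eta> $ 2)) + \<xi> $ 3 * \<eta> $ 3"

lemma unimodular: "(C + D * cos a) * (C - D * cos a) - (D * sin a)\<^sup>2 = 1"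
proof -
  have "(C + D * cos a) * (C - D * cos a) - (D * sin a)\<^sup>2 = C\<^sup>2 - D\<^sup>2 * ((cos a)\<^sup>2 + (sin a)\<^sup>2)"
    by algebra
  then show ?thesis using det1 by simp
qed

text \<open>
  Completing the square; \<open>r p - q\<^sup>2\<close> is the determinant of the form.
\<close>
lemma planar_form_nonneg:
  assumes "r * p - q\<^sup>2 = 1" "r > 0"
  shows "r * y\<^sup>2 + 2 * q * (y * z) + p * z\<^sup>2 \<ge> (0::real)"
proof -
  have "r * (r * y\<^sup>2 + 2 * q * (y * z) + p * z\<^sup>2) = (r * y + q * z)\<^sup>2 + (r * p - q\<^sup>2) * z\<^sup>2"
    by (simp add: algebra_simps power2_eq_square)
  then have "r * (r * y\<^sup>2 + 2 * q * (y * z) + p * z\<^sup>2) \<ge> 0" using assms(1) by simp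
  then show ?thesis using assms(2) by (simp add: zero_le_mult_iff)
qed

lemma bivector_norm_eq_dual_form:
  "bivector_norm_sq (g x) u v = dual_form x (cross3 u v) (cross3 u v)"
proof -
  define p r q w where "p = C - D * cos (4 * pi * x $ 3)" and "r = C + D * cos (4 * pi * x $ 3)"
    and "q = D * sin (4 * pi * x $ 3)" and "w = (\<rho> (x $ 3))\<^sup>2"
  have 1: "r * p - q\<^sup>2 = 1" unfolding p_def q_def r_def by (rule unimodular)
  have "bivector_norm_sq (g x) u v =
    (p * (u $ 1 * u $ 1) - q * (u $ 1 * u $ 2 + u $ 2 * u $ 1) + r * (u $ 2 * u $ 2) + w * (u $ 3 * u $ 3)) *
    (p * (v $ 1 * v $ 1) - q * (v $ 1 * v $ 2 + v $ 2 * v $ 1) + r * (v $ 2 * v $ 2) + w * (v $ 3 * v $ 3)) -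
    (p * (u $ 1 * v $ 1) - q * (u $ 1 * v $ 2 + u $ 2 * v $ 1) + r * (u $ 2 * v $ 2) + w * (u $ 3 * v $ 3))\<^sup>2"
    unfolding bivector_norm_sq_def metric_form p_def q_def r_def w_def ..
  also have "\<dots> = w * (r * (u $ 2 * v $ 3 - u $ 3 * v $ 2)\<^sup>2
      + 2 * q * ((u $ 2 * v $ 3 - u $ 3 * v $ 2) * (u $ 3 * v $ 1 - u $ 1 * v $ 3))
      + p * (u $ 3 * v $ 1 - u $ 1 * v $ 3)\<^sup>2) + (r * p - q\<^sup>2) * (u $ 1 * v $ 2 - u $ 2 * v $ 1)\<^sup>2"
    by algebra
  also have "\<dots> = dual_form x (cross3 u v) (cross3 u v)"
    unfolding 1 dual_form_def p_def[symmetric] r_def[symmetric] q_def[symmetric] w_def[symmetric]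
    by (simp add: cross3_def power2_eq_square algebra_simps)
  finally show ?thesis .
qed

text \<open>
  The difference of the two sides is written as a sum of a squared determinant, for the planar block, and
  a value of the planar form, for the mixed terms.
\<close>
lemma dual_form_Cauchy_Schwarz: "(dual_form x \<xi> \<eta>)\<^sup>2 \<le> dual_form x \<xi> \<xi> * dual_form x \<eta> \<eta>"
proof -
  define p r q w where "p = C - D * cos (4 * pi * x $ 3)" and "r = C + D * cos (4 * pi * x $ 3)"
    and "q = D * sin (4 * pi * x $ 3)" and "w = (\<rho> (x $ 3))\<^sup>2"
  have 1: "r * p - q\<^sup>2 = 1" unfolding p_def q_def r_def by (rule unimodular)
  have r: "r > 0" unfolding r_def by (rule osc_pos)
  \<comment> \<open>The planar part of the combination of \<open>\<xi>\<close> and \<open>\<eta>\<close> whose third component vanishes.\<close>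
  define y where "y = \<eta> $ 3 * \<xi> $ 1 - \<xi> $ 3 * \<eta> $ 1"
  define z where "z = \<eta> $ 3 * \<xi> $ 2 - \<xi> $ 3 * \<eta> $ 2"
  have "dual_form x \<xi> \<xi> * dual_form x \<eta> \<eta> - (dual_form x \<xi> \<eta>)\<^sup>2
     = w\<^sup>2 * (r * p - q\<^sup>2) * (\<xi> $ 1 * \<eta> $ 2 - \<xi> $ 2 * \<eta> $ 1)\<^sup>2 + w * (r * y\<^sup>2 + 2 * q * (y * z) + p * z\<^sup>2)"
    unfolding dual_form_def p_def[symmetric] r_def[symmetric] q_def[symmetric] w_def[symmetric] y_def z_def
    by algebra
  moreover have "\<dots> \<ge> 0"
    using 1 planar_form_nonneg[OF 1 r, of y z] by (simp add: w_def)
  ultimately show ?thesis by linarith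
qed

lemma dual_form_scale: "dual_form x (k *\<^sub>R \<xi>) (k *\<^sub>R \<xi>) = k\<^sup>2 * dual_form x \<xi> \<xi>"
  by (simp add: dual_form_def power2_eq_square algebra_simps)

lemma dual_form_nonneg: "dual_form x \<xi> \<xi> \<ge> 0"
proof -
  have "r * p - q\<^sup>2 = 1 \<Longrightarrow> r > 0 \<Longrightarrow> w * (r * (y * y) + q * (y * z + z * y) + p * (z * z)) + a * a \<ge> 0"
    if "w \<ge> 0" for r p q w y z a :: real
    using mult_nonneg_nonneg[OF that planar_form_nonneg[of r p q y z]]
    by (simp add: power2_eq_square algebra_simps add_nonneg_nonneg)
  from this[OF zero_le_power2 unimodular osc_pos(1)] show ?thesis unfolding dual_form_def .
qed

text \<open>
  The dual form is nondegenerate. This bounds the set whose supremum is the comass, which is needed before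
  the supremum says anything.
\<close>
lemma dual_form_surj: "\<exists>\<eta>. \<forall>\<xi>. w \<bullet> \<xi> = dual_form x \<eta> \<xi>"
proof -
  define p r q \<nu> where "p = C - D * cos (4 * pi * x $ 3)" and "r = C + D * cos (4 * pi * x $ 3)"
    and "q = D * sin (4 * pi * x $ 3)" and "\<nu> = (\<rho> (x $ 3))\<^sup>2"
  have 1: "r * p - q\<^sup>2 = 1" unfolding p_def q_def r_def by (rule unimodular)
  have \<nu>: "\<nu> \<noteq> 0" unfolding \<nu>_def using speed_pos[of "x $ 3"] by simp
  define \<eta> :: "real^3" where
    "\<eta> = vector [(p * w $ 1 - q * w $ 2) / \<nu>, (r * w $ 2 - q * w $ 1) / \<nu>, w $ 3]"
  have "dual_form x \<eta> \<xi> = w \<bullet> \<xi>" for \<xi>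
  proof -
    have "dual_form x \<eta> \<xi> = (r * p - q\<^sup>2) * (w $ 1 * \<xi> $ 1) + (r * p - q\<^sup>2) * (w $ 2 * \<xi> $ 2) + w $ 3 * \<xi> $ 3"
      unfolding dual_form_def p_def[symmetric] r_def[symmetric] q_def[symmetric] \<nu>_def[symmetric] \<eta>_def
      using \<nu> by (simp add: field_simps power2_eq_square)
    then show ?thesis by (simp add: 1 inner_vec_def sum_3)
  qed
  then show ?thesis by metis
qed

lemma comass_leI:
  assumes "\<And>\<xi>. dual_form x \<xi> \<xi> \<le> 1 \<Longrightarrow> w \<bullet> \<xi> \<le> k"
  shows "comass g x w \<le> k"
  unfolding comass_def bivector_norm_eq_dual_form
proof (rule cSup_least)
  have "dual_form x (cross3 0 0) (cross3 0 0) \<le> 1" by (simp add: dual_form_def)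
  then show "{w \<bullet> cross3 u v |u v. dual_form x (cross3 u v) (cross3 u v) \<le> 1} \<noteq> {}" by blast
qed (use assms in auto)

lemma le_comass:
  assumes "dual_form x \<xi> \<xi> \<le> 1"
  shows "w \<bullet> \<xi> \<le> comass g x w"
  unfolding comass_def bivector_norm_eq_dual_form
proof (rule cSup_upper)
  obtain u v where "cross3 u v = \<xi>" using cross3_surj by blast
  then show "w \<bullet> \<xi> \<in> {w \<bullet> cross3 u v |u v. dual_form x (cross3 u v) (cross3 u v) \<le> 1}"
    using assms by blast
  obtain \<eta> where \<eta>: "\<And>\<xi>. w \<bullet> \<xi> = dual_form x \<eta> \<xi>" using dual_form_surj by blast
  show "bdd_above {w \<bullet> cross3 u v |u v. dual_form x (cross3 u v) (cross3 u v) \<le> 1}"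
  proof (rule bdd_aboveI[of _ "sqrt (dual_form x \<eta> \<eta>)"])
    fix z assume "z \<in> {w \<bullet> cross3 u v |u v. dual_form x (cross3 u v) (cross3 u v) \<le> 1}"
    then obtain \<xi> where z: "z = dual_form x \<eta> \<xi>" "dual_form x \<xi> \<xi> \<le> 1" using \<eta> by blast
    have "z\<^sup>2 \<le> dual_form x \<eta> \<eta> * dual_form x \<xi> \<xi>"
      unfolding z by (rule dual_form_Cauchy_Schwarz)
    also have "\<dots> \<le> dual_form x \<eta> \<eta> * 1"
      by (intro mult_left_mono z dual_form_nonneg)
    finally show "z \<le> sqrt (dual_form x \<eta> \<eta>)" by (simp add: real_le_rsqrt)
  qed
qed

lemma pairing_le:
  assumes "comass g x w \<le> 1" and N: "dual_form x \<theta> \<theta> = N\<^sup>2" "N \<ge> 0"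
  shows "\<theta> \<bullet> w \<le> N"
proof (cases "N = 0")
  case True
  \<comment> \<open>A null vector may be scaled arbitrarily within the unit ball.\<close>
  have "k * (w \<bullet> \<theta>) \<le> 1" for k
    using le_comass[of x "k *\<^sub>R \<theta>" w] assms True by (simp add: dual_form_scale)
  from this[of "2 / (w \<bullet> \<theta>)"] have "w \<bullet> \<theta> = 0" by (cases "w \<bullet> \<theta> = 0") auto
  then show ?thesis using True by (simp add: inner_commute)
next
  case False
  have "w \<bullet> ((1 / N) *\<^sub>R \<theta>) \<le> comass g x w"
    by (rule le_comass) (use False in \<open>simp add: dual_form_scale N power_divide\<close>)
  then have "(w \<bullet> \<theta>) / N \<le> 1" using assms(1) by simp
  then show ?thesis using False N(2) by (simp add: inner_commute pos_divide_le_eq)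
qed

lemma metric_smooth: "smooth_on_open UNIV g"
  unfolding screw_metric_def by (intro smooth_screw_matrix el_const el_coord open_UNIV)

lemma riemannian: "riemannian_metric g"
  unfolding riemannian_metric_def
proof (intro conjI allI impI metric_smooth)
  show "periodic g"
    unfolding periodic_def
  proof (intro allI ballI)
    fix x n :: "real^3" assume "n \<in> lattice3"
    then have n: "n $ 3 \<in> \<int>" by (auto simp: lattice3_def)
    show "g (x + n) = g x"
      by (simp only: screw_metric_def screw_matrix_def vector_add_component trig_int_period'[OF n]
          speed_periodic[OF n])
  qed
  show "transpose (g x) = g x" for x
    by (simp add: vec_eq_iff forall_3 transpose_def screw_metric_def screw_matrix_def)
  fix x v :: "real^3" assume v: "v \<noteq> 0"
  define p r q \<nu> where "p = C - D * cos (4 * pi * x $ 3)" and "r = C + D * cos (4 * pi * x $ 3)"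
    and "q = D * sin (4 * pi * x $ 3)" and "\<nu> = (\<rho> (x $ 3))\<^sup>2"
  have det: "r * p - q\<^sup>2 = 1" unfolding p_def q_def r_def by (rule unimodular)
  have p: "p > 0" unfolding p_def by (rule osc_pos)
  have \<nu>: "\<nu> > 0" unfolding \<nu>_def using speed_pos[of "x $ 3"] by simp
  have "p * (v \<bullet> (g x *v v)) = (p * v $ 1 - q * v $ 2)\<^sup>2 + (r * p - q\<^sup>2) * (v $ 2)\<^sup>2 + p * \<nu> * (v $ 3)\<^sup>2"
    unfolding metric_form p_def[symmetric] r_def[symmetric] q_def[symmetric] \<nu>_def[symmetric] by algebra
  also have "\<dots> > 0"
  proof -
    have "v $ 1 \<noteq> 0 \<or> v $ 2 \<noteq> 0 \<or> v $ 3 \<noteq> 0"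
      using v by (auto simp: vec_eq_iff forall_3)
    then consider (third) "v $ 3 \<noteq> 0" | (second) "v $ 2 \<noteq> 0" | (first) "v $ 2 = 0" "v $ 1 \<noteq> 0" by blast
    then show ?thesis
    proof cases
      case third
      then have "p * \<nu> * (v $ 3)\<^sup>2 > 0" using p \<nu> by simp
      then show ?thesis unfolding det by (intro add_nonneg_pos) auto
    next
      case second
      have pos: "(p * v $ 1 - q * v $ 2)\<^sup>2 + (r * p - q\<^sup>2) * (v $ 2)\<^sup>2 > 0"
        unfolding det using second by (intro add_nonneg_pos) auto
      show ?thesis by (rule add_pos_nonneg[OF pos]) (use p \<nu> in simp)
    next
      case first
      have "(p * v $ 1 - q * v $ 2)\<^sup>2 > 0" using first p by simp
      then show ?thesis unfolding det using p \<nu> by (intro add_pos_nonneg) auto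
    qed
  qed
  finally show "v \<bullet> (g x *v v) > 0" using p by (simp add: zero_less_mult_iff)
qed

text \<open>
  The layer form \<open>\<theta>\<close> has third component proportional to \<open>width\<close>. This makes its pointwise norm the
  constant \<open>P\<close> times \<open>width\<close>, so the mass is \<open>P\<close>, and makes the third component of the calibration \<open>\<omega>\<close>,
  which is \<open>\<theta>\<close> raised by the dual form and normalised, the constant \<open>c / P\<close>. For \<open>P = 0\<close> division by
  zero gives \<open>\<omega> = 0\<close>, which is still a calibration.
\<close>
lemma stable_norm_polar:
  assumes \<phi>: "0 \<le> \<phi>" "\<phi> \<le> 2 * pi"
  shows "stable_norm g (r_class (R * cos \<phi>) (R * sin \<phi>) c) = ereal (sqrt (R\<^sup>2 + c\<^sup>2))"
proof -
  define P where "P = sqrt (R\<^sup>2 + c\<^sup>2)"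
  have P0: "P \<ge> 0" and P2: "P\<^sup>2 = R\<^sup>2 + c\<^sup>2" by (auto simp: P_def)
  define f where "f = (\<lambda>t. c * width \<phi> t)"
  define \<theta> where "\<theta> = layer_form (R * cos \<phi>) (R * sin \<phi>) f"
  have fc: "continuous_on UNIV f"
    unfolding f_def by (intro continuous_intros continuous_width)
  have mean: "integral (cbox 0 1) (\<lambda>x::real^3. f (x $ 3)) = c"
    unfolding f_def using integral_width[OF \<phi>] by simp
  have per: "f (t + 1) = f t" for t
    using speed_periodic[of 1] breadth_periodic[of 1] by (simp add: f_def width_def)
  have "\<exists>U. (\<forall>t. (U has_real_derivative f t - c) (at t)) \<and> (\<forall>t. U (t + 1) = U t)"
    by (rule periodic_antiderivative[OF fc per mean]) blast
  then obtain U where U: "\<And>t. (U has_real_derivative f t - c) (at t)" "\<And>t. U (t + 1) = U t"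
    by blast
  have breadth_eq: "(breadth C D \<phi> t)\<^sup>2 = (C + D * cos (4 * pi * t)) * (cos \<phi>)\<^sup>2
      + 2 * (D * sin (4 * pi * t)) * (cos \<phi> * sin \<phi>) + (C - D * cos (4 * pi * t)) * (sin \<phi>)\<^sup>2" for t
  proof -
    have "(C + D * u) * y\<^sup>2 + 2 * (D * w) * (y * z) + (C - D * u) * z\<^sup>2
        = C * (y\<^sup>2 + z\<^sup>2) + D * (u * (y\<^sup>2 - z\<^sup>2) + w * (2 * z * y))" for u w y z
      by algebra
    from this[of "cos (4 * pi * t)" "cos \<phi>" "sin (4 * pi * t)" "sin \<phi>"] show ?thesis
      unfolding breadth_sq cos_diff cos_double sin_double sin_cos_squared_add2 mult_1_right by (rule sym)
  qed
  have norm_\<theta>: "dual_form x (\<theta> x) (\<theta> x) = (width \<phi> (x $ 3) * P)\<^sup>2" for x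
  proof -
    have "dual_form x (\<theta> x) (\<theta> x) = (\<rho> (x $ 3))\<^sup>2 * (R\<^sup>2 * (breadth C D \<phi> (x $ 3))\<^sup>2) + (c * width \<phi> (x $ 3))\<^sup>2"
      unfolding breadth_eq by (simp add: dual_form_def \<theta>_def f_def power2_eq_square algebra_simps)
    then show ?thesis unfolding power_mult_distrib P2 by (simp add: width_def algebra_simps power_mult_distrib)
  qed
  define \<omega>1 where "\<omega>1 = (\<lambda>t. R / P * (\<rho> t * ((C + D * cos (4 * pi * t)) * cos \<phi> + D * sin (4 * pi * t) * sin \<phi>)
      / breadth C D \<phi> t))"
  define \<omega>2 where "\<omega>2 = (\<lambda>t. R / P * (\<rho> t * (D * sin (4 * pi * t) * cos \<phi> + (C - D * cos (4 * pi * t)) * sin \<phi>)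
      / breadth C D \<phi> t))"
  define \<omega> :: "real^3 \<Rightarrow> real^3" where "\<omega> = (\<lambda>x. vector [\<omega>1 (x $ 3), \<omega>2 (x $ 3), c / P])"
  have pair: "\<omega> x \<bullet> \<xi> = dual_form x (\<theta> x) \<xi> / (width \<phi> (x $ 3) * P)" for x \<xi>
  proof (cases "P = 0")
    case False
    then show ?thesis
      using speed_pos[of "x $ 3"] breadth_pos[of \<phi> "x $ 3"]
      by (simp add: \<omega>_def \<omega>1_def \<omega>2_def dual_form_def \<theta>_def f_def width_def inner_vec_def sum_3
          field_simps power2_eq_square)
  qed (simp add: \<omega>_def \<omega>1_def \<omega>2_def inner_vec_def sum_3)
  have sm: "smooth_on_open UNIV \<omega>"
  proof (intro smooth_on_open_vecI elementary_imp_smooth open_UNIV)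
    have b: "elementary UNIV (\<lambda>x::real^3. breadth C D \<phi> (x $ 3))"
      unfolding breadth_def using osc_pos
      by (intro el_sqrt el_add el_diff el_mult el_cos el_const el_coord) auto
    have s: "elementary UNIV (\<lambda>x::real^3. \<rho> (x $ 3))"
      unfolding speed_def by (intro el_add el_mult el_cos el_sin el_const el_coord)
    have e12: "elementary UNIV (\<lambda>x::real^3. \<omega>1 (x $ 3))" "elementary UNIV (\<lambda>x::real^3. \<omega>2 (x $ 3))"
      unfolding \<omega>1_def \<omega>2_def using breadth_pos[of \<phi>]
      by (intro el_add el_diff el_mult el_divide el_cos el_sin el_const el_coord s b;
          simp add: less_imp_neq[symmetric])+
    show "elementary UNIV (\<lambda>x. \<omega> x $ i)" for i
      by (rule all_3I[where P = "\<lambda>i. elementary UNIV (\<lambda>x. \<omega> x $ i)"])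
         (simp_all add: \<omega>_def el_const e12)
  qed
  have form: "smooth_form \<omega>"
    unfolding smooth_form_def periodic_def
  proof (intro conjI sm allI ballI)
    fix x n :: "real^3" assume "n \<in> lattice3"
    then have n: "n $ 3 \<in> \<int>" by (auto simp: lattice3_def)
    show "\<omega> (x + n) = \<omega> x"
      by (simp only: \<omega>_def \<omega>1_def \<omega>2_def vector_add_component trig_int_period'[OF n]
          speed_periodic[OF n] breadth_periodic[OF n])
  qed
  show ?thesis
    unfolding P_def[symmetric]
  proof (rule stable_norm_eqI[OF fc U, where cal = \<omega>])
    fix \<sigma> assume \<sigma>: "smooth_form \<sigma>" "\<And>x. comass g x (\<sigma> x) \<le> 1"
    have "wedge_current \<theta> \<sigma> \<le> integral (cbox 0 1) (\<lambda>x::real^3. width \<phi> (x $ 3) * P)"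
      unfolding wedge_current_def
    proof (rule integral_le)
      show "(\<lambda>x. \<theta> x \<bullet> \<sigma> x) integrable_on cbox 0 1"
        unfolding \<theta>_def
        by (intro integrable_cont continuous_on_inner continuous_layer_form fc smooth_form_continuous \<sigma>)
      show "(\<lambda>x::real^3. width \<phi> (x $ 3) * P) integrable_on cbox 0 1"
        by (intro integrable_cont continuous_on_mult continuous_on_const continuous_layer continuous_width)
      show "\<theta> x \<bullet> \<sigma> x \<le> width \<phi> (x $ 3) * P" for x
        using width_pos[of \<phi> "x $ 3"] P0 by (intro pairing_le[OF \<sigma>(2) norm_\<theta>]) auto
    qed
    also have "\<dots> = P" using integral_width[OF \<phi>] by simp
    finally show "wedge_current (layer_form (R * cos \<phi>) (R * sin \<phi>) f) \<sigma> \<le> P" by (simp add: \<theta>_def)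
  next
    show "comass g x (\<omega> x) \<le> 1" for x
    proof (rule comass_leI)
      fix \<xi> assume \<xi>: "dual_form x \<xi> \<xi> \<le> 1"
      let ?N = "width \<phi> (x $ 3) * P"
      have N: "?N \<ge> 0" using width_pos[of \<phi> "x $ 3"] P0 by simp
      have "(dual_form x (\<theta> x) \<xi>)\<^sup>2 \<le> ?N\<^sup>2 * dual_form x \<xi> \<xi>"
        using dual_form_Cauchy_Schwarz[of x "\<theta> x" \<xi>] unfolding norm_\<theta> .
      also have "\<dots> \<le> ?N\<^sup>2 * 1" by (intro mult_left_mono \<xi>) simp
      finally have "dual_form x (\<theta> x) \<xi> \<le> ?N" unfolding mult_1_right using N by (rule power2_le_imp_le)
      then show "\<omega> x \<bullet> \<xi> \<le> 1"
        unfolding pair using N by (cases "?N = 0") (auto simp: divide_le_eq)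
    qed
    show "ext_d2 \<omega> x = 0" for x
    proof -
      have d: "\<omega> differentiable (at x)" by (rule smooth_differentiable[OF sm]) simp
      have "partial (axis i 1) (\<lambda>y. \<omega> y $ i) x = 0" for i
      proof (rule partial_invariant_zero)
        show "(\<lambda>y. \<omega> y $ i) differentiable (at x)" by (rule smooth_form_component[OF form])
        show "\<omega> (x + h *\<^sub>R axis i 1) $ i = \<omega> x $ i" for h
          by (rule all_3I[where P = "\<lambda>i. \<omega> (x + h *\<^sub>R axis i 1) $ i = \<omega> x $ i"])
             (simp_all add: \<omega>_def axis_def)
      qed
      then show ?thesis by (simp add: ext_d2_def)
    qed
    have "vector [R * cos \<phi>, R * sin \<phi>, c] \<bullet> \<omega> x = R\<^sup>2 / P * width \<phi> (x $ 3) + c\<^sup>2 / P" for x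
    proof -
      have b: "breadth C D \<phi> (x $ 3) \<noteq> 0" using breadth_pos[of \<phi> "x $ 3"] by simp
      have "vector [R * cos \<phi>, R * sin \<phi>, c] \<bullet> \<omega> x =
        R\<^sup>2 / P * (\<rho> (x $ 3) * (breadth C D \<phi> (x $ 3))\<^sup>2 / breadth C D \<phi> (x $ 3)) + c\<^sup>2 / P"
        unfolding breadth_eq
        by (simp add: \<omega>_def \<omega>1_def \<omega>2_def inner_vec_def sum_3 power2_eq_square algebra_simps
            add_divide_distrib diff_divide_distrib)
      then show ?thesis using b by (simp add: width_def power2_eq_square)
    qed
    then have "wedge_current (\<lambda>x. vector [R * cos \<phi>, R * sin \<phi>, c]) \<omega>
       = integral (cbox 0 1) (\<lambda>x::real^3. R\<^sup>2 / P * width \<phi> (x $ 3) + c\<^sup>2 / P)"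
      by (simp add: wedge_current_def)
    also have "\<dots> = integral (cbox 0 1) (\<lambda>x::real^3. R\<^sup>2 / P * width \<phi> (x $ 3))
       + integral (cbox 0 1) (\<lambda>x::real^3. c\<^sup>2 / P)"
      by (intro integral_add integrable_cont continuous_intros continuous_layer continuous_width)
    also have "\<dots> = R\<^sup>2 / P + c\<^sup>2 / P"
      using integral_width[OF \<phi>] by (simp add: content_cbox_if_cart interval_eq_empty_cart)
    also have "\<dots> = P"
      unfolding add_divide_distrib[symmetric] P2[symmetric] by (simp add: power2_eq_square)
    finally show "wedge_current (\<lambda>x. vector [R * cos \<phi>, R * sin \<phi>, c]) \<omega> = P" .
  qed (rule form)
qed

theorem stable_norm_screw: "stable_norm g (r_class a b c) = ereal (sqrt (a\<^sup>2 + b\<^sup>2 + c\<^sup>2))"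
proof -
  define R where "R = sqrt (a\<^sup>2 + b\<^sup>2)"
  have R2: "R\<^sup>2 = a\<^sup>2 + b\<^sup>2" by (simp add: R_def)
  have "\<exists>\<phi>. 0 \<le> \<phi> \<and> \<phi> \<le> 2 * pi \<and> a = R * cos \<phi> \<and> b = R * sin \<phi>"
  proof (cases "R = 0")
    case True
    then have "a = 0" "b = 0" using R2 by (simp_all add: sum_power2_eq_zero_iff)
    then show ?thesis using True by (intro exI[of _ 0]) simp
  next
    case False
    have "(a / R)\<^sup>2 + (b / R)\<^sup>2 = 1"
      unfolding power_divide add_divide_distrib[symmetric] R2[symmetric] using False by simp
    then obtain \<phi> where "0 \<le> \<phi>" "\<phi> < 2 * pi" "a / R = cos \<phi>" "b / R = sin \<phi>"
      by (rule sincos_total_2pi)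
    then show ?thesis using False by (intro exI[of _ \<phi>]) (auto simp: field_simps)
  qed
  then obtain \<phi> where \<phi>: "0 \<le> \<phi>" "\<phi> \<le> 2 * pi" "a = R * cos \<phi>" "b = R * sin \<phi>" by blast
  show ?thesis
    using stable_norm_polar[OF \<phi>(1,2), of R c] unfolding R2 \<phi>(3,4)[symmetric] .
qed

end

text \<open>
  For a circle instead of an ellipse and a constant weight the metric is the flat one, so the flat torus
  is covered by the same computation of the stable norm.
\<close>
lemma screw_flat: "screw_metric 1 0 0 0 = flat_metric"
proof -
  have "normalizer 1 0 = 1"
    by (simp add: normalizer_def breadth_def content_cbox_if_cart interval_eq_empty_cart)
  then show ?thesis
    by (auto simp: screw_metric_def screw_matrix_def speed_def flat_metric_def vec_eq_iff forall_3
        mat_def fun_eq_iff)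
qed

section \<open>Curvature of screw metrics\<close>

lemma matrix_inv_eqI:
  fixes A B :: "real^'n^'n"
  assumes "A ** B = mat 1" "B ** A = mat 1"
  shows "matrix_inv A = B"
  unfolding matrix_inv_def
proof (rule some_equality)
  fix X assume "A ** X = mat 1 \<and> X ** A = mat 1"
  then have "X ** (A ** B) = B" unfolding matrix_mul_assoc by simp
  then show "X = B" using assms by simp
qed (use assms in simp)

context screw
begin

lemma speed_nonzero [simp]: "\<rho> t \<noteq> 0"
  using speed_pos[of t] by simp

lemma matrix_inv_metric:
  "matrix_inv (g x) = vector
     [vector [C + D * cos (4 * pi * x $ 3), D * sin (4 * pi * x $ 3), 0],
      vector [D * sin (4 * pi * x $ 3), C - D * cos (4 * pi * x $ 3), 0],
      vector [0, 0, 1 / (\<rho> (x $ 3))\<^sup>2]]" (is "_ = ?B")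
proof -
  have u: "(C + D * cos a) * (C - D * cos a) - D * sin a * (D * sin a) = 1"
    "(C - D * cos a) * (C + D * cos a) - D * sin a * (D * sin a) = 1" for a
    using unimodular[of a] by (simp_all add: power2_eq_square mult.commute)
  have "g x ** ?B = mat 1" "?B ** g x = mat 1"
    unfolding vec_eq_iff forall_3
    by (simp_all add: matrix_matrix_mult_def sum_3 mat_def screw_metric_def screw_matrix_def u mult.commute)
  then show ?thesis by (rule matrix_inv_eqI)
qed

lemma partial_metric:
  shows "partial (axis 1 1) (\<lambda>y. g y $ i $ j) x = 0"
    and "partial (axis 2 1) (\<lambda>y. g y $ i $ j) x = 0"
    and "partial (axis 3 1) (\<lambda>y. g y $ 1 $ 2) x = - (4 * pi * D * cos (4 * pi * x $ 3))"
    and "partial (axis 3 1) (\<lambda>y. g y $ 2 $ 1) x = - (4 * pi * D * cos (4 * pi * x $ 3))"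
    and "partial (axis 3 1) (\<lambda>y. g y $ 2 $ 2) x = - (4 * pi * D * sin (4 * pi * x $ 3))"
    and "partial (axis 3 1) (\<lambda>y. g y $ 1 $ 1) x = 4 * pi * D * sin (4 * pi * x $ 3)"
proof -
  have "elementary UNIV (\<lambda>y. g y $ i $ j)"
    unfolding screw_metric_def by (intro elementary_screw_matrix el_const el_coord)
  then have d: "(\<lambda>y. g y $ i $ j) differentiable (at x)"
    by (rule elementary_differentiable) simp
  show "partial (axis 1 1) (\<lambda>y. g y $ i $ j) x = 0" "partial (axis 2 1) (\<lambda>y. g y $ i $ j) x = 0"
    by (rule partial_invariant_zero[OF d], simp add: screw_metric_def axis_def)+
  have p: "partial (axis 3 1) (\<lambda>y::real^3. U (y $ 3)) x = d"
    if "(U has_real_derivative d) (at (x $ 3))" for U d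
    using partial_layer(2)[OF that, of "axis 3 1"] by (simp add: axis_def)
  show "partial (axis 3 1) (\<lambda>y. g y $ 1 $ 2) x = - (4 * pi * D * cos (4 * pi * x $ 3))"
    "partial (axis 3 1) (\<lambda>y. g y $ 2 $ 1) x = - (4 * pi * D * cos (4 * pi * x $ 3))"
    "partial (axis 3 1) (\<lambda>y. g y $ 2 $ 2) x = - (4 * pi * D * sin (4 * pi * x $ 3))"
    "partial (axis 3 1) (\<lambda>y. g y $ 1 $ 1) x = 4 * pi * D * sin (4 * pi * x $ 3)"
    unfolding screw_metric_def
    by (rule p; simp add: screw_matrix_def; (auto intro!: derivative_eq_intros)[1])+
qed

lemma metric_offdiag: "g y $ 1 $ 3 = 0" "g y $ 3 $ 1 = 0" "g y $ 2 $ 3 = 0" "g y $ 3 $ 2 = 0"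
  by (simp_all add: screw_metric_def screw_matrix_def)

lemma partial_const: "partial v (\<lambda>x. k) = (\<lambda>x. 0)"
  by (rule ext, rule partial_eq[where D = "\<lambda>v. 0"]) simp

text \<open>
  In the component \<open>R(e\<^sub>1, e\<^sub>2) e\<^sub>2\<close> the derivative terms drop out, because Christoffel symbols with three
  planar indices vanish identically. At the origin only the product of two symbols that contain the
  off-diagonal derivative of the rotating block survives.
\<close>
lemma not_flat:
  assumes "D > 0"
  shows "\<not> is_flat g"
proof
  assume "is_flat g"
  then have "riemann_curvature g 1 2 1 2 0 = 0" by (simp add: is_flat_def)
  moreover have c12: "christoffel g 1 2 2 = (\<lambda>x. 0)" "christoffel g 1 1 2 = (\<lambda>x. 0)"
      "christoffel g 1 1 1 = (\<lambda>x. 0)" "christoffel g 2 1 2 = (\<lambda>x. 0)" "christoffel g 2 2 2 = (\<lambda>x. 0)"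
      "christoffel g 1 2 1 = (\<lambda>x. 0)"
    by (auto simp: christoffel_def sum_3 partial_metric matrix_inv_metric fun_eq_iff)
  moreover have "christoffel g 3 2 2 0 = 0"
    by (simp add: christoffel_def sum_3 partial_metric matrix_inv_metric)
  moreover have "christoffel g 3 1 2 0 = 2 * pi * D / (\<rho> 0)\<^sup>2"
    by (simp add: christoffel_def sum_3 partial_metric matrix_inv_metric metric_offdiag partial_const)
  moreover have "christoffel g 1 2 3 0 = - (2 * pi * D * (C + D))"
    by (simp add: christoffel_def sum_3 partial_metric matrix_inv_metric metric_offdiag partial_const)
  ultimately have "2 * pi * D * (C + D) * (2 * pi * D / (\<rho> 0)\<^sup>2) = 0"
    by (simp add: riemann_curvature_def sum_3 partial_const)
  then show False using assms C1 by simp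
qed

end

section \<open>Isometry invariants from short loops\<close>

definition c1_curve :: "(real \<Rightarrow> real^3) \<Rightarrow> (real \<Rightarrow> real^3) \<Rightarrow> bool" where
  "c1_curve \<gamma> \<gamma>' \<longleftrightarrow>
     (\<forall>t\<in>{0..1}. (\<gamma> has_vector_derivative \<gamma>' t) (at t within {0..1})) \<and> continuous_on {0..1} \<gamma>'"

definition curve_length :: "(real^3 \<Rightarrow> real^3^3) \<Rightarrow> (real \<Rightarrow> real^3) \<Rightarrow> (real \<Rightarrow> real^3) \<Rightarrow> real" where
  "curve_length g \<gamma> \<gamma>' = integral {0..1} (\<lambda>t. sqrt (\<gamma>' t \<bullet> (g (\<gamma> t) *v \<gamma>' t)))"

definition joinable :: "(real^3 \<Rightarrow> real^3^3) \<Rightarrow> real \<Rightarrow> real^3 \<Rightarrow> real^3 \<Rightarrow> bool" where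
  "joinable g \<delta> x y \<longleftrightarrow>
     (\<exists>\<gamma> \<gamma>'. c1_curve \<gamma> \<gamma>' \<and> \<gamma> 0 = x \<and> \<gamma> 1 = y \<and> curve_length g \<gamma> \<gamma>' \<le> \<delta>)"

text \<open>
  A closed curve on the torus that is not contractible lifts to a curve whose end points differ by a
  nonzero lattice vector.
\<close>
definition on_short_loop :: "(real^3 \<Rightarrow> real^3^3) \<Rightarrow> real \<Rightarrow> real^3 \<Rightarrow> bool" where
  "on_short_loop g L x \<longleftrightarrow> (\<exists>n\<in>lattice3 - {0}. joinable g L x (x + n))"

definition loop_connected :: "(real^3 \<Rightarrow> real^3^3) \<Rightarrow> real \<Rightarrow> real^3 \<Rightarrow> real^3 \<Rightarrow> bool" where
  "loop_connected g L x y \<longleftrightarrow>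
     (\<exists>\<gamma> \<gamma>'. c1_curve \<gamma> \<gamma>' \<and> \<gamma> 0 = x \<and> \<gamma> 1 = y \<and> (\<forall>t\<in>{0..1}. on_short_loop g L (\<gamma> t)))"

text \<open>
  The point is within distance \<open>\<delta>\<close> of a component of the set swept by short loops other than its own
  component. Components are taken in the universal cover.
\<close>
definition neighbour_within :: "(real^3 \<Rightarrow> real^3^3) \<Rightarrow> real \<Rightarrow> real \<Rightarrow> real^3 \<Rightarrow> bool" where
  "neighbour_within g L \<delta> x \<longleftrightarrow>
     (\<exists>y. on_short_loop g L y \<and> \<not> loop_connected g L x y \<and> joinable g \<delta> x y)"

definition c1_map :: "(real^3 \<Rightarrow> real^3) \<Rightarrow> (real^3 \<Rightarrow> real^3 \<Rightarrow> real^3) \<Rightarrow> bool" where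
  "c1_map \<Phi> \<Phi>' \<longleftrightarrow> (\<forall>x. (\<Phi> has_derivative \<Phi>' x) (at x)) \<and> (\<forall>u. continuous_on UNIV (\<lambda>x. \<Phi>' x u))"

text \<open>
  An isometry of tori, lifted to the universal cover and normalised so that the lift of the inverse map
  is a left inverse.
\<close>
definition lift_isometry where
  "lift_isometry g h \<Phi> \<Phi>' \<Psi> \<longleftrightarrow> c1_map \<Phi> \<Phi>' \<and> (\<forall>x. \<forall>n\<in>lattice3. \<Phi> (x + n) - \<Phi> x \<in> lattice3) \<and>
     (\<forall>x. \<Psi> (\<Phi> x) = x) \<and> (\<forall>x u v. \<Phi>' x u \<bullet> (h (\<Phi> x) *v \<Phi>' x v) = u \<bullet> (g x *v v))"

lemma c1_curve_continuous: "c1_curve \<gamma> \<gamma>' \<Longrightarrow> continuous_on {0..1} \<gamma>"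
  unfolding c1_curve_def
  by (meson continuous_on_eq_continuous_within has_vector_derivative_continuous)

lemma c1_map_linear: "c1_map \<Phi> \<Phi>' \<Longrightarrow> bounded_linear (\<Phi>' x)"
  unfolding c1_map_def by (blast intro: has_derivative_bounded_linear)

lemma c1_curve_image:
  assumes \<Phi>: "c1_map \<Phi> \<Phi>'" and \<gamma>: "c1_curve \<gamma> \<gamma>'"
  shows "c1_curve (\<lambda>t. \<Phi> (\<gamma> t)) (\<lambda>t. \<Phi>' (\<gamma> t) (\<gamma>' t))"
  unfolding c1_curve_def
proof (intro conjI ballI)
  fix t :: real assume t: "t \<in> {0..1}"
  have "(\<gamma> has_derivative (\<lambda>k. k *\<^sub>R \<gamma>' t)) (at t within {0..1})"
    using \<gamma> t by (auto simp: c1_curve_def has_vector_derivative_def)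
  then have "((\<lambda>t. \<Phi> (\<gamma> t)) has_derivative (\<lambda>k. \<Phi>' (\<gamma> t) (k *\<^sub>R \<gamma>' t))) (at t within {0..1})"
    by (rule has_derivative_compose) (use \<Phi> in \<open>simp add: c1_map_def\<close>)
  then show "((\<lambda>t. \<Phi> (\<gamma> t)) has_vector_derivative \<Phi>' (\<gamma> t) (\<gamma>' t)) (at t within {0..1})"
    unfolding has_vector_derivative_def by (simp add: linear_simps[OF c1_map_linear[OF \<Phi>]])
next
  have eq: "\<Phi>' x v = (\<Sum>b\<in>Basis. (v \<bullet> b) *\<^sub>R \<Phi>' x b)" for x v
  proof -
    have "\<Phi>' x v = \<Phi>' x (\<Sum>b\<in>Basis. (v \<bullet> b) *\<^sub>R b)" by (simp add: euclidean_representation)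
    also have "\<dots> = (\<Sum>b\<in>Basis. (v \<bullet> b) *\<^sub>R \<Phi>' x b)"
      using bounded_linear.linear[OF c1_map_linear[OF \<Phi>]] by (simp add: linear_sum linear_scale)
    finally show ?thesis .
  qed
  have c: "continuous_on {0..1} (\<lambda>t. \<Phi>' (\<gamma> t) b)" for b
    by (rule continuous_on_compose2[of UNIV "\<lambda>x. \<Phi>' x b"])
       (use \<Phi> c1_curve_continuous[OF \<gamma>] in \<open>auto simp: c1_map_def\<close>)
  have "continuous_on {0..1} (\<lambda>t. \<Sum>b\<in>Basis. (\<gamma>' t \<bullet> b) *\<^sub>R \<Phi>' (\<gamma> t) b)"
    using \<gamma> unfolding c1_curve_def by (intro continuous_intros c) auto
  then show "continuous_on {0..1} (\<lambda>t. \<Phi>' (\<gamma> t) (\<gamma>' t))"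
    by (subst eq)
qed

lemma joinable_image:
  assumes iso: "lift_isometry g h \<Phi> \<Phi>' \<Psi>" and "joinable g \<delta> x y"
  shows "joinable h \<delta> (\<Phi> x) (\<Phi> y)"
proof -
  obtain \<gamma> \<gamma>' where \<gamma>: "c1_curve \<gamma> \<gamma>'" "\<gamma> 0 = x" "\<gamma> 1 = y" "curve_length g \<gamma> \<gamma>' \<le> \<delta>"
    using assms(2) by (auto simp: joinable_def)
  have "curve_length h (\<lambda>t. \<Phi> (\<gamma> t)) (\<lambda>t. \<Phi>' (\<gamma> t) (\<gamma>' t)) = curve_length g \<gamma> \<gamma>'"
    using iso by (simp add: curve_length_def lift_isometry_def)
  then show ?thesis
    unfolding joinable_def using \<gamma> iso c1_curve_image
    by (intro exI[of _ "\<lambda>t. \<Phi> (\<gamma> t)"] exI[of _ "\<lambda>t. \<Phi>' (\<gamma> t) (\<gamma>' t)"])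
       (simp add: lift_isometry_def)
qed

lemma on_short_loop_image:
  assumes iso: "lift_isometry g h \<Phi> \<Phi>' \<Psi>" and "on_short_loop g L x"
  shows "on_short_loop h L (\<Phi> x)"
proof -
  obtain n where n: "n \<in> lattice3" "n \<noteq> 0" "joinable g L x (x + n)"
    using assms(2) by (auto simp: on_short_loop_def)
  let ?m = "\<Phi> (x + n) - \<Phi> x"
  have "?m \<in> lattice3" using iso n(1) by (auto simp: lift_isometry_def)
  moreover have "?m \<noteq> 0"
  proof
    assume "?m = 0"
    then have "\<Psi> (\<Phi> (x + n)) = \<Psi> (\<Phi> x)" by simp
    then show False using iso n(2) by (simp add: lift_isometry_def)
  qed
  moreover have "joinable h L (\<Phi> x) (\<Phi> x + ?m)" using joinable_image[OF iso n(3)] by simp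
  ultimately show ?thesis unfolding on_short_loop_def by blast
qed

lemma loop_connected_image:
  assumes iso: "lift_isometry g h \<Phi> \<Phi>' \<Psi>" and "loop_connected g L x y"
  shows "loop_connected h L (\<Phi> x) (\<Phi> y)"
proof -
  obtain \<gamma> \<gamma>' where \<gamma>: "c1_curve \<gamma> \<gamma>'" "\<gamma> 0 = x" "\<gamma> 1 = y" "\<forall>t\<in>{0..1}. on_short_loop g L (\<gamma> t)"
    using assms(2) by (auto simp: loop_connected_def)
  show ?thesis
    unfolding loop_connected_def
    using \<gamma> iso on_short_loop_image[OF iso] c1_curve_image[OF _ \<gamma>(1), of \<Phi> \<Phi>']
    by (intro exI[of _ "\<lambda>t. \<Phi> (\<gamma> t)"] exI[of _ "\<lambda>t. \<Phi>' (\<gamma> t) (\<gamma>' t)"])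
       (simp add: lift_isometry_def)
qed

lemma neighbour_within_image:
  assumes iso: "lift_isometry g h \<Phi> \<Phi>' \<Psi>" and inv: "lift_isometry h g \<Psi> \<Psi>' \<Phi>"
    and "neighbour_within g L \<delta> x"
  shows "neighbour_within h L \<delta> (\<Phi> x)"
proof -
  obtain y where y: "on_short_loop g L y" "\<not> loop_connected g L x y" "joinable g \<delta> x y"
    using assms(3) by (auto simp: neighbour_within_def)
  have "\<not> loop_connected h L (\<Phi> x) (\<Phi> y)"
    using loop_connected_image[OF inv, of L "\<Phi> x" "\<Phi> y"] y(2) iso by (auto simp: lift_isometry_def)
  then show ?thesis
    using y on_short_loop_image[OF iso] joinable_image[OF iso] unfolding neighbour_within_def by blast
qed

text \<open>
  The components are continuous and integer-valued on a connected space.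
\<close>
lemma lattice_valued_constant:
  fixes F :: "real^3 \<Rightarrow> real^3"
  assumes "continuous_on UNIV F" "\<And>x. F x \<in> lattice3"
  shows "F x = F y"
proof -
  have "(\<lambda>x. F x $ i) constant_on UNIV" for i
  proof (rule continuous_discrete_range_constant)
    show "continuous_on UNIV (\<lambda>x. F x $ i)" by (intro continuous_intros assms)
    fix x
    have int: "F z $ i \<in> \<int>" for z using assms(2)[of z] by (simp add: lattice3_def)
    show "\<exists>e>0. \<forall>y. y \<in> UNIV \<and> F y $ i \<noteq> F x $ i \<longrightarrow> e \<le> norm (F y $ i - F x $ i)"
    proof (rule exI[of _ 1], intro conjI allI impI)
      fix y assume "y \<in> UNIV \<and> F y $ i \<noteq> F x $ i"
      then show "1 \<le> norm (F y $ i - F x $ i)"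
        using Ints_nonzero_abs_ge1[OF Ints_diff[OF int int], of y x] by simp
    qed simp
  qed auto
  then show ?thesis unfolding vec_eq_iff constant_on_def by (metis UNIV_I)
qed

lemma torus_map_lift_c1:
  assumes "torus_map_lift \<Phi>"
  shows "c1_map \<Phi> (\<lambda>x u. partial u \<Phi> x)"
proof -
  have sm: "smooth_on_open UNIV \<Phi>" using assms by (simp add: torus_map_lift_def)
  have d: "(\<Phi> has_derivative (\<lambda>u. partial u \<Phi> x)) (at x)" for x
    unfolding partial_def using smooth_differentiable[OF sm] frechet_derivative_works by auto
  have eq: "partial u \<Phi> x = (\<Sum>b\<in>Basis. (u \<bullet> b) *\<^sub>R partial b \<Phi> x)" for u x
  proof -
    have "linear (\<lambda>u. partial u \<Phi> x)" using d by (rule has_derivative_linear)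
    from linear_sum[OF this, of "\<lambda>b. (u \<bullet> b) *\<^sub>R b" Basis] linear_scale[OF this]
    show ?thesis by (simp add: euclidean_representation)
  qed
  have "continuous_on UNIV (partial b \<Phi>)" if "b \<in> Basis" for b
    using smooth_partial_differentiable[OF sm _ that]
    by (meson UNIV_I continuous_at_imp_continuous_on differentiable_imp_continuous_within)
  then have "continuous_on UNIV (\<lambda>x. \<Sum>b\<in>Basis. (u \<bullet> b) *\<^sub>R partial b \<Phi> x)" for u
    by (intro continuous_intros) auto
  then show ?thesis using d by (simp add: c1_map_def eq[symmetric])
qed

text \<open>
  The given lifts are inverse to each other up to lattice vectors, which are constant by continuity; after
  subtracting this constant they are inverse maps. That the inverse preserves the metrics follows from the
  chain rule.
\<close>
lemma isometric_lifts:
  assumes "isometric g h"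
  obtains \<Phi> \<Phi>' \<Psi> \<Psi>' where "lift_isometry g h \<Phi> \<Phi>' \<Psi>" "lift_isometry h g \<Psi> \<Psi>' \<Phi>"
proof -
  from assms obtain \<Phi> \<Psi> where *: "torus_map_lift \<Phi>" "torus_map_lift \<Psi>"
     "\<And>x. \<Psi> (\<Phi> x) - x \<in> lattice3" "\<And>x. \<Phi> (\<Psi> x) - x \<in> lattice3"
     "\<And>x u v. partial u \<Phi> x \<bullet> (h (\<Phi> x) *v partial v \<Phi> x) = u \<bullet> (g x *v v)"
    unfolding isometric_def by blast
  have c: "continuous_on UNIV \<Phi>" "continuous_on UNIV \<Psi>"
    using torus_map_lift_c1[OF *(1)] torus_map_lift_c1[OF *(2)] unfolding c1_map_def
    by (meson has_derivative_continuous continuous_at_imp_continuous_on)+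
  define n where "n = \<Psi> (\<Phi> 0) - 0"
  have n: "\<Psi> (\<Phi> x) = x + n" for x
    using lattice_valued_constant[of "\<lambda>x. \<Psi> (\<Phi> x) - x" x 0] *(3) c
    by (simp add: n_def continuous_on_compose2[OF c(2,1)] continuous_on_diff algebra_simps)
  define m where "m = \<Phi> (\<Psi> 0) - 0"
  have m: "\<Phi> (\<Psi> x) = x + m" for x
    using lattice_valued_constant[of "\<lambda>x. \<Phi> (\<Psi> x) - x" x 0] *(4) c
    by (simp add: m_def continuous_on_compose2[OF c(1,2)] continuous_on_diff algebra_simps)
  define \<Theta> where "\<Theta> = (\<lambda>x. \<Psi> x - n)"
  have left: "\<Theta> (\<Phi> x) = x" for x by (simp add: \<Theta>_def n)
  have right: "\<Phi> (\<Theta> x) = x" for x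
    using left[of "\<Psi> (x - m)"] m[of "x - m"] by simp
  define \<Phi>' where "\<Phi>' = (\<lambda>x u. partial u \<Phi> x)"
  define \<Psi>' where "\<Psi>' = (\<lambda>x u. partial u \<Psi> x)"
  have c1: "c1_map \<Phi> \<Phi>'" unfolding \<Phi>'_def by (rule torus_map_lift_c1[OF *(1)])
  have "(\<Theta> has_derivative \<Psi>' x) (at x)" for x
    using has_derivative_diff[OF _ has_derivative_const, of \<Psi> "\<Psi>' x" "at x" n]
      torus_map_lift_c1[OF *(2)] by (simp add: c1_map_def \<Theta>_def \<Psi>'_def)
  then have c1': "c1_map \<Theta> \<Psi>'"
    using torus_map_lift_c1[OF *(2)] by (simp add: c1_map_def \<Psi>'_def)
  have chain: "\<Phi>' (\<Theta> z) (\<Psi>' z u) = u" for z u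
  proof -
    have "((\<lambda>z. \<Phi> (\<Theta> z)) has_derivative (\<lambda>u. \<Phi>' (\<Theta> z) (\<Psi>' z u))) (at z)"
      by (rule has_derivative_compose) (use c1 c1' in \<open>auto simp: c1_map_def\<close>)
    moreover have "((\<lambda>z. \<Phi> (\<Theta> z)) has_derivative (\<lambda>u. u)) (at z)"
      unfolding right by (rule has_derivative_ident)
    ultimately show ?thesis using has_derivative_unique by metis
  qed
  have "lift_isometry g h \<Phi> \<Phi>' \<Theta>"
    unfolding lift_isometry_def using c1 *(1) left *(5) by (simp add: torus_map_lift_def \<Phi>'_def)
  moreover have "lift_isometry h g \<Theta> \<Psi>' \<Phi>"
    unfolding lift_isometry_def
  proof (intro conjI allI ballI c1' right)
    show "\<Theta> (x + k) - \<Theta> x \<in> lattice3" if "k \<in> lattice3" for x k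
      using *(2) that by (simp add: torus_map_lift_def \<Theta>_def)
    show "\<Psi>' z u \<bullet> (g (\<Theta> z) *v \<Psi>' z v) = u \<bullet> (h z *v v)" for z u v
      using *(5)[of "\<Psi>' z u" "\<Theta> z" "\<Psi>' z v"] unfolding \<Phi>'_def[symmetric]
      using chain[of z] right by (simp add: \<Phi>'_def)
  qed
  ultimately show ?thesis by (rule that)
qed

lemma isometric_neighbour_invariant:
  assumes "isometric g h"
  shows "(\<exists>x. on_short_loop g L x \<and> neighbour_within g L \<delta> x) \<longleftrightarrow>
         (\<exists>x. on_short_loop h L x \<and> neighbour_within h L \<delta> x)"
    and "(\<exists>x. on_short_loop g L x \<and> \<not> neighbour_within g L \<delta> x) \<longleftrightarrow>
         (\<exists>x. on_short_loop h L x \<and> \<not> neighbour_within h L \<delta> x)"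
proof -
  obtain \<Phi> \<Phi>' \<Psi> \<Psi>' where iso: "lift_isometry g h \<Phi> \<Phi>' \<Psi>" and inv: "lift_isometry h g \<Psi> \<Psi>' \<Phi>"
    using isometric_lifts[OF assms] by metis
  have l: "\<Psi> (\<Phi> x) = x" "\<Phi> (\<Psi> x) = x" for x
    using iso inv by (auto simp: lift_isometry_def)
  have osl: "on_short_loop h L (\<Phi> x) \<longleftrightarrow> on_short_loop g L x" for x
    using on_short_loop_image[OF iso] on_short_loop_image[OF inv] l by metis
  have nw: "neighbour_within h L \<delta> (\<Phi> x) \<longleftrightarrow> neighbour_within g L \<delta> x" for x
    using neighbour_within_image[OF iso inv] neighbour_within_image[OF inv iso] l by metis
  show "(\<exists>x. on_short_loop g L x \<and> neighbour_within g L \<delta> x) \<longleftrightarrow>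
         (\<exists>x. on_short_loop h L x \<and> neighbour_within h L \<delta> x)"
    "(\<exists>x. on_short_loop g L x \<and> \<not> neighbour_within g L \<delta> x) \<longleftrightarrow>
         (\<exists>x. on_short_loop h L x \<and> \<not> neighbour_within h L \<delta> x)"
    using osl nw l(2) by metis+
qed

section \<open>Short loops of screw metrics\<close>

context screw
begin

text \<open>
  The arc length along the \<open>t\<close>-direction, that is, an antiderivative of the weight.
\<close>
definition travel where
  "travel t = normalizer C D * (t + (\<alpha> * sin (2 * pi * t) - \<beta> * cos (2 * pi * t)) / (2 * pi))"

lemma travel_deriv: "(travel has_real_derivative \<rho> t) (at t within S)"
  unfolding travel_def[abs_def] speed_def
  by (auto intro!: derivative_eq_intros simp: field_simps)

lemma travel_mono: "s \<le> t \<Longrightarrow> travel s \<le> travel t"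
  using DERIV_nonneg_imp_nondecreasing[of s t travel] travel_deriv speed_pos less_imp_le by blast

lemma travel_periodic: "k \<in> \<int> \<Longrightarrow> travel (t + k) = travel t + normalizer C D * k"
  by (simp only: travel_def trig_int_period') (simp add: algebra_simps)

text \<open>
  The planar block is \<open>C - D\<close> times the Euclidean form plus a square that vanishes exactly in the
  direction \<open>(cos (2\<pi>t), sin (2\<pi>t))\<close>, where lengths are therefore smallest.
\<close>
lemma metric_split:
  "v \<bullet> (g x *v v) = (C - D) * ((v $ 1)\<^sup>2 + (v $ 2)\<^sup>2)
     + 2 * D * (sin (2 * pi * x $ 3) * v $ 1 - cos (2 * pi * x $ 3) * v $ 2)\<^sup>2
     + (\<rho> (x $ 3) * v $ 3)\<^sup>2"
proof -
  have eq: "4 * pi * x $ 3 = 2 * (2 * pi * x $ 3)" by simp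
  have key: "(C - D * (1 - 2 * s\<^sup>2)) * (v $ 1 * v $ 1) - D * (2 * s * c) * (v $ 1 * v $ 2 + v $ 2 * v $ 1)
      + (C + D * (2 * c\<^sup>2 - 1)) * (v $ 2 * v $ 2) + r\<^sup>2 * (v $ 3 * v $ 3)
    = (C - D) * ((v $ 1)\<^sup>2 + (v $ 2)\<^sup>2) + 2 * D * (s * v $ 1 - c * v $ 2)\<^sup>2 + (r * v $ 3)\<^sup>2"
    for s c r :: real
    by algebra
  show ?thesis
    unfolding metric_form eq
    using key[of "sin (2 * pi * x $ 3)" "cos (2 * pi * x $ 3)" "\<rho> (x $ 3)"]
    unfolding sin_double[symmetric] cos_double_sin[symmetric] cos_double_cos[symmetric] .
qed

lemma speed_le_norm: "\<rho> (x $ 3) * \<bar>v $ 3\<bar> \<le> sqrt (v \<bullet> (g x *v v))"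
  and short_le_norm: "i \<noteq> 3 \<Longrightarrow> sqrt (C - D) * \<bar>v $ i\<bar> \<le> sqrt (v \<bullet> (g x *v v))"
proof -
  have *: "(C - D) * ((v $ 1)\<^sup>2 + (v $ 2)\<^sup>2) \<ge> 0" "C - D \<ge> 0"
    "2 * D * (sin (2 * pi * x $ 3) * v $ 1 - cos (2 * pi * x $ 3) * v $ 2)\<^sup>2 \<ge> 0"
    using DC D0 by auto
  then show "\<rho> (x $ 3) * \<bar>v $ 3\<bar> \<le> sqrt (v \<bullet> (g x *v v))"
    unfolding metric_split
    by (intro real_le_rsqrt) (simp add: power_mult_distrib)
  assume i: "i \<noteq> 3"
  have "(v $ i)\<^sup>2 \<le> (v $ 1)\<^sup>2 + (v $ 2)\<^sup>2"
    using i exhaust_3[of i] by auto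
  then have "(C - D) * (v $ i)\<^sup>2 \<le> (C - D) * ((v $ 1)\<^sup>2 + (v $ 2)\<^sup>2)"
    using * by (intro mult_left_mono) auto
  then show "sqrt (C - D) * \<bar>v $ i\<bar> \<le> sqrt (v \<bullet> (g x *v v))"
    unfolding metric_split using *
    by (intro real_le_rsqrt) (simp add: power_mult_distrib add_increasing2)
qed

lemma continuous_metric_speed:
  assumes "c1_curve \<gamma> \<gamma>'"
  shows "continuous_on {0..1} (\<lambda>t. sqrt (\<gamma>' t \<bullet> (g (\<gamma> t) *v \<gamma>' t)))"
proof -
  have "continuous_on {0..1} \<gamma>'" "continuous_on {0..1} \<gamma>"
    using assms c1_curve_continuous by (auto simp: c1_curve_def)
  moreover from this have "continuous_on {0..1} (\<lambda>t. \<rho> (\<gamma> t $ 3))"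
    by (intro continuous_on_compose2[OF continuous_speed] continuous_intros) auto
  ultimately show ?thesis
    unfolding metric_split by (intro continuous_intros)
qed

lemma curve_component_deriv:
  "c1_curve \<gamma> \<gamma>' \<Longrightarrow> t \<in> {0..1} \<Longrightarrow> ((\<lambda>t. \<gamma> t $ i) has_vector_derivative \<gamma>' t $ i) (at t within {0..1})"
  unfolding c1_curve_def
  by (blast intro: bounded_linear.has_vector_derivative[OF bounded_linear_vec_nth])

lemma length_ge:
  assumes \<gamma>: "c1_curve \<gamma> \<gamma>'"
    and F: "\<And>t. t \<in> {0..1} \<Longrightarrow> (F has_vector_derivative f t) (at t within {0..1})"
    and le: "\<And>t. t \<in> {0..1} \<Longrightarrow> f t \<le> sqrt (\<gamma>' t \<bullet> (g (\<gamma> t) *v \<gamma>' t))"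
  shows "F 1 - F 0 \<le> curve_length g \<gamma> \<gamma>'"
proof -
  have "(f has_integral F 1 - F 0) {0..1}"
    by (rule fundamental_theorem_of_calculus) (auto intro: F)
  moreover have "((\<lambda>t. sqrt (\<gamma>' t \<bullet> (g (\<gamma> t) *v \<gamma>' t))) has_integral curve_length g \<gamma> \<gamma>') {0..1}"
    unfolding curve_length_def
    by (intro integrable_integral integrable_continuous_interval continuous_metric_speed \<gamma>)
  ultimately show ?thesis by (rule has_integral_le) (rule le)
qed

text \<open>
  Two planes of constant \<open>t\<close> are at least as far apart as the weight prescribes.
\<close>
lemma length_ge_travel:
  assumes \<gamma>: "c1_curve \<gamma> \<gamma>'"
  shows "\<bar>travel (\<gamma> 1 $ 3) - travel (\<gamma> 0 $ 3)\<bar> \<le> curve_length g \<gamma> \<gamma>'"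
proof -
  have d: "((\<lambda>t. travel (\<gamma> t $ 3)) has_vector_derivative \<rho> (\<gamma> t $ 3) * \<gamma>' t $ 3) (at t within {0..1})"
    if "t \<in> {0..1}" for t
    using vector_diff_chain_within[OF curve_component_deriv[OF \<gamma> that, of 3], of travel "\<rho> (\<gamma> t $ 3)"]
      travel_deriv[of "\<gamma> t $ 3"]
    by (simp add: has_real_derivative_iff_has_vector_derivative o_def mult.commute)
  have p: "\<rho> (\<gamma> t $ 3) * \<bar>\<gamma>' t $ 3\<bar> = \<bar>\<rho> (\<gamma> t $ 3) * \<gamma>' t $ 3\<bar>" for t
    using speed_pos[of "\<gamma> t $ 3"] by (simp add: abs_mult)
  have "travel (\<gamma> 1 $ 3) - travel (\<gamma> 0 $ 3) \<le> curve_length g \<gamma> \<gamma>'"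
    using speed_le_norm[of "\<gamma> t" "\<gamma>' t" for t] unfolding p
    by (intro length_ge[OF \<gamma> d]) (auto dest: abs_le_D1)
  moreover have "(- travel (\<gamma> 1 $ 3)) - (- travel (\<gamma> 0 $ 3)) \<le> curve_length g \<gamma> \<gamma>'"
    using speed_le_norm[of "\<gamma> t" "\<gamma>' t" for t] unfolding p
    by (intro length_ge[OF \<gamma> has_vector_derivative_minus[OF d]]) (auto dest: abs_le_D2)
  ultimately show ?thesis by linarith
qed

text \<open>
  Loops in the \<open>t\<close>-direction have length at least \<open>normalizer C D\<close>, so they are longer than the shortest
  loops in the plane. The estimate holds because the breadth is at most \<open>sqrt (C + D)\<close>, the inverse
  of \<open>sqrt (C - D)\<close>, and not constant.
\<close>
lemma normalizer_gt:
  assumes "D > 0"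
  shows "sqrt (C - D) < normalizer C D"
proof -
  let ?I = "integral (cbox 0 1) (\<lambda>x::real^3. breadth C D 0 (x $ 3))"
  have le: "breadth C D 0 t \<le> sqrt (C + D)" for t
    unfolding breadth_def using D0 mult_left_mono[of "cos (4 * pi * t - 2 * 0)" 1 D] by simp
  have c: "continuous_on UNIV (\<lambda>x::real^3. sqrt (C + D) - breadth C D 0 (x $ 3))"
    by (intro continuous_intros continuous_layer continuous_breadth)
  let ?J = "integral (cbox 0 1) (\<lambda>x::real^3. sqrt (C + D) - breadth C D 0 (x $ 3))"
  have J: "?J = sqrt (C + D) - ?I"
  proof -
    have "?J = integral (cbox 0 1) (\<lambda>x::real^3. sqrt (C + D)) - ?I"
      by (intro integral_diff integrable_cont continuous_on_const continuous_layer continuous_breadth)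
    then show ?thesis by (simp add: content_cbox_if_cart interval_eq_empty_cart)
  qed
  have "?J \<noteq> 0"
  proof
    assume "?J = 0"
    then have "\<forall>x\<in>cbox 0 1. sqrt (C + D) - breadth C D 0 ((x::real^3) $ 3) = 0"
      using le by (subst (asm) integral_cbox_eq_0_iff)
        (auto intro: continuous_on_subset[OF c] simp: interval_ne_empty_cart)
    \<comment> \<open>At \<open>t = 1/4\<close> the breadth takes its smallest value \<open>sqrt (C - D)\<close>.\<close>
    moreover have "((\<chi> i. 1 / 4) :: real^3) \<in> cbox 0 1" by (simp add: mem_box_cart)
    ultimately have "sqrt (C + D) - breadth C D 0 (1 / 4) = 0" by fastforce
    then show False using assms by (simp add: breadth_def)
  qed
  moreover have "?J \<ge> 0" by (rule integral_nonneg) (auto intro!: integrable_cont c simp: le)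
  ultimately have I: "?I < sqrt (C + D)" unfolding J by linarith
  have "sqrt (C - D) * sqrt (C + D) = 1"
    unfolding real_sqrt_mult[symmetric] using det1 by (simp add: power2_eq_square algebra_simps)
  moreover have "sqrt (C - D) * ?I < sqrt (C - D) * sqrt (C + D)"
    using I DC by (intro mult_strict_left_mono) auto
  ultimately show ?thesis
    unfolding normalizer_def using integral_breadth_0_pos by (simp add: field_simps)
qed

text \<open>
  The displacement of a loop of length at most \<open>sqrt (C - D)\<close> has a nonzero component \<open>i\<close> in the plane, and
  the integral of \<open>sqrt (C - D)\<close> times that velocity component is already at least the length. So equality holds
  pointwise: the curve stays at constant \<open>t\<close>, moves along the axis \<open>i\<close>, and lengths are smallest in
  that direction, which makes \<open>sin (4\<pi>t)\<close> vanish.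
\<close>
lemma short_loop_plane:
  assumes D: "D > 0" and "on_short_loop g (sqrt (C - D)) x"
  shows "4 * x $ 3 \<in> \<int>"
proof -
  let ?L = "sqrt (C - D)"
  have L: "?L > 0" and L2: "?L\<^sup>2 = C - D" using DC by auto
  obtain n \<gamma> \<gamma>' where n: "n \<in> lattice3" "n \<noteq> 0" and \<gamma>: "c1_curve \<gamma> \<gamma>'" "\<gamma> 0 = x" "\<gamma> 1 = x + n"
    and len: "curve_length g \<gamma> \<gamma>' \<le> ?L"
    using assms(2) by (auto simp: on_short_loop_def joinable_def)
  have int: "n $ i \<in> \<int>" for i using n(1) by (simp add: lattice3_def)
  have "\<exists>i. i \<noteq> 3 \<and> n $ i \<noteq> 0"
  proof (rule ccontr)
    assume "\<nexists>i. i \<noteq> 3 \<and> n $ i \<noteq> 0"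
    then have "n $ i = 0" if "i \<noteq> 3" for i using that by blast
    from this[of 1] this[of 2] have "n $ 1 = 0" "n $ 2 = 0" by simp_all
    then have n3: "n $ 3 \<noteq> 0" using n(2) by (auto simp: vec_eq_iff forall_3)
    have "\<bar>travel (\<gamma> 1 $ 3) - travel (\<gamma> 0 $ 3)\<bar> = normalizer C D * \<bar>n $ 3\<bar>"
      using \<gamma> travel_periodic[OF int] normalizer_pos by (simp add: abs_mult)
    also have "\<dots> \<ge> normalizer C D * 1"
      using Ints_nonzero_abs_ge1[OF int n3] normalizer_pos by (intro mult_left_mono) auto
    finally show False using length_ge_travel[OF \<gamma>(1)] len normalizer_gt[OF D] by linarith
  qed
  then obtain i where i: "i \<noteq> 3" "n $ i \<noteq> 0" by blast
  define \<sigma> where "\<sigma> = sgn (n $ i)"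
  have \<sigma>: "\<sigma> * n $ i = \<bar>n $ i\<bar>" "\<bar>\<sigma>\<bar> = 1" using i by (auto simp: \<sigma>_def sgn_if)
  let ?f = "\<lambda>t. sqrt (\<gamma>' t \<bullet> (g (\<gamma> t) *v \<gamma>' t))"
  let ?h = "\<lambda>t. ?L * (\<sigma> * \<gamma>' t $ i)"
  have "((\<lambda>t. ?L * (\<sigma> * \<gamma> t $ i)) has_vector_derivative ?h t) (at t within {0..1})" if "t \<in> {0..1}" for t
    by (intro has_vector_derivative_mult_right curve_component_deriv[OF \<gamma>(1) that])
  then have int_h: "(?h has_integral ?L * (\<sigma> * \<gamma> 1 $ i) - ?L * (\<sigma> * \<gamma> 0 $ i)) {0..1}"
    by (intro fundamental_theorem_of_calculus) auto
  have end_h: "?L * (\<sigma> * \<gamma> 1 $ i) - ?L * (\<sigma> * \<gamma> 0 $ i) = ?L * \<bar>n $ i\<bar>"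
    unfolding \<sigma>(1)[symmetric] by (simp add: \<gamma> algebra_simps)
  have hint: "integral {0..1} ?h = ?L * \<bar>n $ i\<bar>"
    using integral_unique[OF int_h] unfolding end_h .
  have n1: "?L * \<bar>n $ i\<bar> \<ge> ?L * 1"
    using Ints_nonzero_abs_ge1[OF int i(2)] L by (intro mult_left_mono) auto
  have le: "?h t \<le> ?f t" for t
  proof -
    have "?h t \<le> ?L * \<bar>\<gamma>' t $ i\<bar>"
      using L \<sigma>(2) abs_ge_self[of "\<sigma> * \<gamma>' t $ i"] by (intro mult_left_mono) (auto simp: abs_mult)
    then show ?thesis using short_le_norm[OF i(1), of "\<gamma>' t" "\<gamma> t"] by linarith
  qed
  have \<gamma>'c: "continuous_on {0..1} \<gamma>'" using \<gamma>(1) by (simp add: c1_curve_def)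
  have hc: "continuous_on {0..1} ?h" by (intro continuous_intros \<gamma>'c)
  note fc = continuous_metric_speed[OF \<gamma>(1)]
  have "integral {0..1} (\<lambda>t. ?f t - ?h t) = curve_length g \<gamma> \<gamma>' - ?L * \<bar>n $ i\<bar>"
    unfolding curve_length_def hint[symmetric]
    by (intro integral_diff integrable_continuous_interval fc hc)
  also have "\<dots> \<le> 0" using len n1 by simp
  finally have "integral {0..1} (\<lambda>t. ?f t - ?h t) \<le> 0" .
  moreover have "integral {0..1} (\<lambda>t. ?f t - ?h t) \<ge> 0"
    by (intro integral_nonneg integrable_continuous_interval continuous_on_diff fc hc) (simp add: le)
  ultimately have "integral {0..1} (\<lambda>t. ?f t - ?h t) = 0" by simp
  then have "\<forall>t\<in>{0..1}. ?f t - ?h t = 0"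
    by (subst (asm) integral_eq_0_iff) (auto intro!: continuous_on_diff fc hc le)
  then have eq: "?f t = ?h t" if "t \<in> {0..1}" for t using that by simp
  have sq: "\<gamma>' t \<bullet> (g (\<gamma> t) *v \<gamma>' t) = (C - D) * (\<gamma>' t $ i)\<^sup>2" if "t \<in> {0..1}" for t
  proof -
    have "\<sigma>\<^sup>2 = 1" using \<sigma>(2) by (metis one_power2 power2_abs)
    have "\<gamma>' t \<bullet> (g (\<gamma> t) *v \<gamma>' t) \<ge> 0"
      unfolding metric_split using DC D0 by simp
    then have "\<gamma>' t \<bullet> (g (\<gamma> t) *v \<gamma>' t) = (?f t)\<^sup>2" by simp
    also have "\<dots> = (?h t)\<^sup>2" using eq[OF that] by simp
    also have "\<dots> = (C - D) * (\<gamma>' t $ i)\<^sup>2"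
      unfolding power_mult_distrib L2 \<open>\<sigma>\<^sup>2 = 1\<close> by simp
    finally show ?thesis .
  qed
  \<comment> \<open>Equality leaves no room for the other velocity components.\<close>
  have trap: "\<gamma>' t $ 3 = 0 \<and> sin (2 * pi * \<gamma> t $ 3) * cos (2 * pi * \<gamma> t $ 3) * \<gamma>' t $ i = 0" if t: "t \<in> {0..1}" for t
  proof -
    define s c where "s = sin (2 * pi * \<gamma> t $ 3)" and "c = cos (2 * pi * \<gamma> t $ 3)"
    define v where "v = \<gamma>' t"
    have i12: "i = 1 \<or> i = 2" using i(1) exhaust_3[of i] by blast
    have e: "(C - D) * ((v $ 1)\<^sup>2 + (v $ 2)\<^sup>2) + 2 * D * (s * v $ 1 - c * v $ 2)\<^sup>2 + (\<rho> (\<gamma> t $ 3) * v $ 3)\<^sup>2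
        = (C - D) * (v $ i)\<^sup>2"
      using sq[OF t] unfolding metric_split s_def c_def v_def .
    define j :: 3 where "j = (if i = 1 then 2 else 1)"
    have j: "(v $ 1)\<^sup>2 + (v $ 2)\<^sup>2 = (v $ i)\<^sup>2 + (v $ j)\<^sup>2"
      using i12 by (auto simp: j_def)
    have "(C - D) * (v $ j)\<^sup>2 + 2 * D * (s * v $ 1 - c * v $ 2)\<^sup>2 + (\<rho> (\<gamma> t $ 3) * v $ 3)\<^sup>2 = 0"
      using e unfolding j by (simp add: distrib_left)
    moreover have "(C - D) * (v $ j)\<^sup>2 \<ge> 0" "2 * D * (s * v $ 1 - c * v $ 2)\<^sup>2 \<ge> 0" "(\<rho> (\<gamma> t $ 3) * v $ 3)\<^sup>2 \<ge> 0"
      using DC D0 by auto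
    ultimately have z: "(C - D) * (v $ j)\<^sup>2 = 0" "2 * D * (s * v $ 1 - c * v $ 2)\<^sup>2 = 0" "(\<rho> (\<gamma> t $ 3) * v $ 3)\<^sup>2 = 0"
      by linarith+
    have "v $ j = 0" "s * v $ 1 - c * v $ 2 = 0" "v $ 3 = 0"
      using z DC D speed_pos[of "\<gamma> t $ 3"] by auto
    then have "v $ 3 = 0 \<and> s * c * v $ i = 0"
      using i12 by (auto simp: j_def)
    then show ?thesis by (simp add: s_def c_def v_def)
  qed
  have "\<gamma> t $ 3 = x $ 3" if "t \<in> {0..1}" for t
  proof -
    have "((\<lambda>t. \<gamma> t $ 3) has_vector_derivative 0) (at t within {0..1})" if "t \<in> {0..1}" for t
      using curve_component_deriv[OF \<gamma>(1) that, of 3] trap[OF that] by simp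
    then have "\<gamma> t $ 3 = \<gamma> 0 $ 3"
      using has_vector_derivative_zero_constant[of "{0..1}" "\<lambda>t. \<gamma> t $ 3"] that by force
    then show ?thesis by (simp add: \<gamma>)
  qed
  note const = this
  have "\<exists>t\<in>{0..1}. \<gamma>' t $ i \<noteq> 0"
  proof (rule ccontr)
    assume "\<not> (\<exists>t\<in>{0..1}. \<gamma>' t $ i \<noteq> 0)"
    then have "(?h has_integral 0) {0..1}" by (intro has_integral_is_0) auto
    then have "?L * \<bar>n $ i\<bar> = 0" unfolding hint[symmetric] by (rule integral_unique)
    then show False using n1 L by simp
  qed
  then obtain t where "t \<in> {0..1}" "\<gamma>' t $ i \<noteq> 0" by blast
  then have "sin (2 * pi * x $ 3) * cos (2 * pi * x $ 3) = 0"
    using trap[of t] const[of t] by simp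
  then have "sin (2 * (2 * pi * x $ 3)) = 0" unfolding sin_double by simp
  then obtain k :: int where "2 * (2 * pi * x $ 3) = of_int k * pi"
    by (auto simp: sin_zero_iff_int2)
  then have "4 * x $ 3 = of_int k" by simp
  then show ?thesis by (simp only: Ints_of_int)
qed

lemma straight_curve: "c1_curve (\<lambda>t. x + t *\<^sub>R v) (\<lambda>t. v)"
  unfolding c1_curve_def by (auto intro!: derivative_eq_intros)

lemma plane_short_loop:
  assumes "4 * x $ 3 \<in> \<int>"
  shows "on_short_loop g (sqrt (C - D)) x"
proof -
  obtain k where k: "4 * x $ 3 = of_int k" using assms by (auto elim: Ints_cases)
  define i :: 3 where "i = (if even k then 1 else 2)"
  define e :: "real^3" where "e = axis i 1"
  have c: "cos (4 * pi * x $ 3) = (if even k then 1 else -1)"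
  proof -
    have "4 * pi * x $ 3 = pi * of_int k" using k by (simp add: algebra_simps)
    then show ?thesis by (simp only: cos_npi_int)
  qed
  have e3: "e $ 3 = 0" by (simp add: e_def i_def axis_def)
  have "e \<bullet> (g (x + t *\<^sub>R e) *v e) = C - D" for t
    unfolding metric_form by (simp add: e_def i_def axis_def c)
  then have "curve_length g (\<lambda>t. x + t *\<^sub>R e) (\<lambda>t. e) \<le> sqrt (C - D)"
    by (simp add: curve_length_def)
  moreover have "e \<in> lattice3 - {0}"
    by (auto simp: lattice3_def e_def axis_def vec_eq_iff)
  ultimately show ?thesis
    unfolding on_short_loop_def joinable_def using straight_curve[of x e]
    by (intro bexI[of _ e] exI[of _ "\<lambda>t. x + t *\<^sub>R e"] exI[of _ "\<lambda>t. e"]) auto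
qed

text \<open>
  Along a connecting curve the integer \<open>4 t\<close> varies continuously and is therefore constant.
\<close>
lemma loop_connected_iff:
  assumes D: "D > 0" and x: "4 * x $ 3 \<in> \<int>"
  shows "loop_connected g (sqrt (C - D)) x y \<longleftrightarrow> y $ 3 = x $ 3"
proof
  assume "loop_connected g (sqrt (C - D)) x y"
  then obtain \<gamma> \<gamma>' where \<gamma>: "c1_curve \<gamma> \<gamma>'" "\<gamma> 0 = x" "\<gamma> 1 = y"
      "\<forall>t\<in>{0..1}. on_short_loop g (sqrt (C - D)) (\<gamma> t)"
    by (auto simp: loop_connected_def)
  have "(\<lambda>t. 4 * \<gamma> t $ 3) constant_on {0..1}"
  proof (rule continuous_discrete_range_constant)
    show "continuous_on {0..1} (\<lambda>t. 4 * \<gamma> t $ 3)"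
      by (intro continuous_intros c1_curve_continuous[OF \<gamma>(1)])
    fix t :: real assume t: "t \<in> {0..1}"
    show "\<exists>e>0. \<forall>u. u \<in> {0..1} \<and> 4 * \<gamma> u $ 3 \<noteq> 4 * \<gamma> t $ 3 \<longrightarrow> e \<le> norm (4 * \<gamma> u $ 3 - 4 * \<gamma> t $ 3)"
    proof (rule exI[of _ 1], intro conjI allI impI)
      fix u :: real assume u: "u \<in> {0..1} \<and> 4 * \<gamma> u $ 3 \<noteq> 4 * \<gamma> t $ 3"
      have "4 * \<gamma> u $ 3 - 4 * \<gamma> t $ 3 \<in> \<int>"
        using short_loop_plane[OF D] \<gamma>(4) t u by (intro Ints_diff) auto
      from Ints_nonzero_abs_ge1[OF this] u show "1 \<le> norm (4 * \<gamma> u $ 3 - 4 * \<gamma> t $ 3)" by simp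
    qed simp
  qed simp
  then have "4 * \<gamma> 1 $ 3 = 4 * \<gamma> 0 $ 3" unfolding constant_on_def by (metis atLeastAtMost_iff order_refl zero_le_one)
  then show "y $ 3 = x $ 3" using \<gamma> by simp
next
  assume y: "y $ 3 = x $ 3"
  show "loop_connected g (sqrt (C - D)) x y"
    unfolding loop_connected_def using straight_curve[of x "y - x"] x y
    by (intro exI[of _ "\<lambda>t. x + t *\<^sub>R (y - x)"] exI[of _ "\<lambda>t. y - x"])
       (auto intro!: plane_short_loop)
qed

text \<open>
  The distance between the consecutive planes \<open>t = k/4\<close> and \<open>t = (k + 1)/4\<close>.
\<close>
definition gap :: "int \<Rightarrow> real" where
  "gap k = travel ((of_int k + 1) / 4) - travel (of_int k / 4)"

lemma joinable_vertical:
  "joinable g (\<bar>travel (x $ 3 + h) - travel (x $ 3)\<bar>) x (x + h *\<^sub>R axis 3 1)"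
proof -
  let ?v = "h *\<^sub>R axis 3 1 :: real^3"
  have v: "?v $ 1 = 0" "?v $ 2 = 0" "?v $ 3 = h" by (simp_all add: axis_def)
  have f: "sqrt (?v \<bullet> (g (x + t *\<^sub>R ?v) *v ?v)) = \<rho> (x $ 3 + t * h) * \<bar>h\<bar>" for t
    unfolding metric_split v using speed_pos[of "x $ 3 + t * h"] by (simp add: v abs_mult del: scaleR_scaleR)
  define \<sigma> where "\<sigma> = sgn h"
  have \<sigma>: "\<bar>h\<bar> = \<sigma> * h" by (auto simp: \<sigma>_def abs_sgn)
  have "((\<lambda>t. \<sigma> * travel (x $ 3 + t * h)) has_vector_derivative \<rho> (x $ 3 + t * h) * \<bar>h\<bar>) (at t within {0..1})" for t
  proof -
    have "((\<lambda>t. travel (x $ 3 + t * h)) has_real_derivative \<rho> (x $ 3 + t * h) * h) (at t within {0..1})"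
      by (rule DERIV_chain2[OF travel_deriv]) (auto intro!: derivative_eq_intros)
    from DERIV_cmult[OF this, of \<sigma>] show ?thesis
      unfolding has_real_derivative_iff_has_vector_derivative[symmetric] \<sigma> by (simp add: mult_ac)
  qed
  then have int: "((\<lambda>t. \<rho> (x $ 3 + t * h) * \<bar>h\<bar>) has_integral \<sigma> * travel (x $ 3 + 1 * h) - \<sigma> * travel (x $ 3 + 0 * h)) {0..1}"
    by (intro fundamental_theorem_of_calculus) auto
  have "curve_length g (\<lambda>t. x + t *\<^sub>R ?v) (\<lambda>t. ?v) = \<sigma> * (travel (x $ 3 + h) - travel (x $ 3))"
    unfolding curve_length_def f integral_unique[OF int] by (simp add: right_diff_distrib)
  also have "\<dots> \<le> \<bar>travel (x $ 3 + h) - travel (x $ 3)\<bar>"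
    by (auto simp: \<sigma>_def sgn_if)
  finally show ?thesis
    unfolding joinable_def using straight_curve[of x ?v]
    by (intro exI[of _ "\<lambda>t. x + t *\<^sub>R ?v"] exI[of _ "\<lambda>t. ?v"]) auto
qed

lemma neighbour_iff:
  assumes D: "D > 0" and x: "4 * x $ 3 = of_int k"
  shows "neighbour_within g (sqrt (C - D)) \<delta> x \<longleftrightarrow> min (gap k) (gap (k - 1)) \<le> \<delta>"
proof
  have xk: "x $ 3 = of_int k / 4" using x by simp
  have xi: "4 * x $ 3 \<in> \<int>" using x by simp
  assume "neighbour_within g (sqrt (C - D)) \<delta> x"
  then obtain y \<gamma> \<gamma>' where y: "on_short_loop g (sqrt (C - D)) y" "\<not> loop_connected g (sqrt (C - D)) x y"
     and \<gamma>: "c1_curve \<gamma> \<gamma>'" "\<gamma> 0 = x" "\<gamma> 1 = y" "curve_length g \<gamma> \<gamma>' \<le> \<delta>"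
    by (auto simp: neighbour_within_def joinable_def)
  obtain j where j: "4 * y $ 3 = of_int j" using short_loop_plane[OF D y(1)] by (auto elim: Ints_cases)
  have yj: "y $ 3 = of_int j / 4" using j by simp
  have "j \<noteq> k" using y(2) loop_connected_iff[OF D xi] xk yj by auto
  have le: "\<bar>travel (of_int j / 4) - travel (of_int k / 4)\<bar> \<le> \<delta>"
    using length_ge_travel[OF \<gamma>(1)] \<gamma> xk yj by simp
  show "min (gap k) (gap (k - 1)) \<le> \<delta>"
  proof (cases "k < j")
    case True
    then have "travel ((of_int k + 1) / 4) \<le> travel (of_int j / 4)"
      by (intro travel_mono) simp
    then have "gap k \<le> \<delta>" using le by (simp add: gap_def)
    then show ?thesis by simp
  next
    case False
    then have "travel (of_int j / 4) \<le> travel (of_int (k - 1) / 4)"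
      using \<open>j \<noteq> k\<close> by (intro travel_mono divide_right_mono) auto
    then have "gap (k - 1) \<le> \<delta>" using le by (simp add: gap_def)
    then show ?thesis by simp
  qed
next
  have xk: "x $ 3 = of_int k / 4" using x by simp
  have xi: "4 * x $ 3 \<in> \<int>" using x by simp
  assume le: "min (gap k) (gap (k - 1)) \<le> \<delta>"
  have step: "neighbour_within g (sqrt (C - D)) \<delta> x"
    if "\<bar>travel (x $ 3 + h) - travel (x $ 3)\<bar> \<le> \<delta>" "4 * (x $ 3 + h) \<in> \<int>" "h \<noteq> 0" for h
  proof -
    let ?y = "x + h *\<^sub>R axis 3 1 :: real^3"
    have y3: "?y $ 3 = x $ 3 + h" by (simp add: axis_def)
    have "on_short_loop g (sqrt (C - D)) ?y" by (rule plane_short_loop) (use that y3 in simp)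
    moreover have "\<not> loop_connected g (sqrt (C - D)) x ?y" using loop_connected_iff[OF D xi] y3 that by simp
    moreover have "joinable g \<delta> x ?y"
      using joinable_vertical[of x h] that(1) by (auto simp: joinable_def intro: order_trans)
    ultimately show ?thesis unfolding neighbour_within_def by blast
  qed
  show "neighbour_within g (sqrt (C - D)) \<delta> x"
  proof (cases "gap k \<le> \<delta>")
    case True
    have e: "x $ 3 + 1 / 4 = (of_int k + 1) / 4" using xk by simp
    have "travel (of_int k / 4) \<le> travel ((of_int k + 1) / 4)" by (rule travel_mono) simp
    then have "\<bar>travel (x $ 3 + 1 / 4) - travel (x $ 3)\<bar> \<le> \<delta>"
      using True unfolding e unfolding xk gap_def by simp
    moreover have "4 * (x $ 3 + 1 / 4) = of_int (k + 1)" using x by simp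
    then have "4 * (x $ 3 + 1 / 4) \<in> \<int>" by (simp only: Ints_of_int)
    ultimately show ?thesis by (rule step) simp
  next
    case False
    then have "gap (k - 1) \<le> \<delta>" using le by simp
    have e: "x $ 3 + (- 1 / 4) = of_int (k - 1) / 4" using xk by simp
    have "travel (of_int (k - 1) / 4) \<le> travel (of_int k / 4)" by (rule travel_mono) simp
    then have "\<bar>travel (x $ 3 + (- 1 / 4)) - travel (x $ 3)\<bar> \<le> \<delta>"
      using \<open>gap (k - 1) \<le> \<delta>\<close> unfolding e unfolding xk gap_def by simp
    moreover have "4 * (x $ 3 + (- 1 / 4)) = of_int (k - 1)" using x by simp
    then have "4 * (x $ 3 + (- 1 / 4)) \<in> \<int>" by (simp only: Ints_of_int)
    ultimately show ?thesis by (rule step) simp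
  qed
qed

lemma gap_values:
  "gap (4 * q) = normalizer C D * (1 / 4 + (\<alpha> + \<beta>) / (2 * pi))"
  "gap (4 * q + 1) = normalizer C D * (1 / 4 + (\<beta> - \<alpha>) / (2 * pi))"
  "gap (4 * q + 2) = normalizer C D * (1 / 4 - (\<alpha> + \<beta>) / (2 * pi))"
  "gap (4 * q + 3) = normalizer C D * (1 / 4 + (\<alpha> - \<beta>) / (2 * pi))"
proof -
  have shift: "gap (4 * q + r) = gap r" for r
  proof -
    have e: "(of_int (4 * q + r) + 1) / 4 = (of_int r + 1) / 4 + (of_int q :: real)"
      "of_int (4 * q + r) / 4 = of_int r / 4 + (of_int q :: real)"
      by (simp_all add: field_simps)
    show ?thesis
      unfolding gap_def e travel_periodic[OF Ints_of_int] by simp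
  qed
  have t: "travel 0 = normalizer C D * (0 - \<beta> / (2 * pi))"
    "travel (1 / 4) = normalizer C D * (1 / 4 + \<alpha> / (2 * pi))"
    "travel (1 / 2) = normalizer C D * (1 / 2 + \<beta> / (2 * pi))"
    "travel (3 / 4) = normalizer C D * (3 / 4 - \<alpha> / (2 * pi))"
    "travel 1 = normalizer C D * (1 - \<beta> / (2 * pi))"
  proof -
    have a: "2 * pi * (1 / 4) = pi / 2" "2 * pi * (1 / 2) = pi" "2 * pi * (3 / 4) = 3 / 2 * pi"
      by simp_all
    show "travel 0 = normalizer C D * (0 - \<beta> / (2 * pi))"
      "travel (1 / 4) = normalizer C D * (1 / 4 + \<alpha> / (2 * pi))"
      "travel (1 / 2) = normalizer C D * (1 / 2 + \<beta> / (2 * pi))"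
      "travel (3 / 4) = normalizer C D * (3 / 4 - \<alpha> / (2 * pi))"
      "travel 1 = normalizer C D * (1 - \<beta> / (2 * pi))"
      unfolding travel_def a sin_3over2_pi cos_3over2_pi by simp_all
  qed
  show "gap (4 * q) = normalizer C D * (1 / 4 + (\<alpha> + \<beta>) / (2 * pi))"
  "gap (4 * q + 1) = normalizer C D * (1 / 4 + (\<beta> - \<alpha>) / (2 * pi))"
  "gap (4 * q + 2) = normalizer C D * (1 / 4 - (\<alpha> + \<beta>) / (2 * pi))"
  "gap (4 * q + 3) = normalizer C D * (1 / 4 + (\<alpha> - \<beta>) / (2 * pi))"
    using shift[of 0] shift[of 1] shift[of 2] shift[of 3] t
    by (simp_all add: gap_def right_diff_distrib distrib_left add_divide_distrib diff_divide_distrib)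
qed

lemma gap_mod4_cases:
  fixes k :: int
  obtains q where "k = 4 * q" | q where "k = 4 * q + 1" | q where "k = 4 * q + 2" | q where "k = 4 * q + 3"
proof -
  have "k = 4 * (k div 4) + k mod 4" by simp
  moreover have "k mod 4 = 0 \<or> k mod 4 = 1 \<or> k mod 4 = 2 \<or> k mod 4 = 3" by presburger
  ultimately show ?thesis using that by (metis add.right_neutral)
qed

text \<open>
  For \<open>0 < \<alpha> < \<beta>\<close> the gaps are ordered in such a way that the distance to the nearest
  other plane is largest for \<open>t = 1/4\<close> and smallest for \<open>t = 1/2\<close> (modulo 1).
\<close>
lemma invariants:
  assumes D: "D > 0" and ab: "0 < \<alpha>" "\<alpha> < \<beta>"
  shows "(\<exists>x. on_short_loop g (sqrt (C - D)) x \<and> neighbour_within g (sqrt (C - D)) \<delta> x) \<longleftrightarrow>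
      normalizer C D * (1 / 4 - (\<alpha> + \<beta>) / (2 * pi)) \<le> \<delta>"
    and "(\<exists>x. on_short_loop g (sqrt (C - D)) x \<and> \<not> neighbour_within g (sqrt (C - D)) \<delta> x) \<longleftrightarrow>
      \<delta> < normalizer C D * (1 / 4 + (\<beta> - \<alpha>) / (2 * pi))"
proof -
  define m where "m k = min (gap k) (gap (k - 1))" for k
  let ?lo = "normalizer C D * (1 / 4 - (\<alpha> + \<beta>) / (2 * pi))"
  let ?hi = "normalizer C D * (1 / 4 + (\<beta> - \<alpha>) / (2 * pi))"
  have ex: "(\<exists>x. on_short_loop g (sqrt (C - D)) x \<and> P (neighbour_within g (sqrt (C - D)) \<delta> x)) \<longleftrightarrow>
      (\<exists>k. P (m k \<le> \<delta>))" for P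
  proof
    assume "\<exists>x. on_short_loop g (sqrt (C - D)) x \<and> P (neighbour_within g (sqrt (C - D)) \<delta> x)"
    then obtain x where x: "on_short_loop g (sqrt (C - D)) x" "P (neighbour_within g (sqrt (C - D)) \<delta> x)"
      by blast
    obtain k where "4 * x $ 3 = of_int k" using short_loop_plane[OF D x(1)] by (auto elim: Ints_cases)
    then show "\<exists>k. P (m k \<le> \<delta>)" using x(2) neighbour_iff[OF D] by (auto simp: m_def)
  next
    assume "\<exists>k. P (m k \<le> \<delta>)"
    then obtain k where k: "P (m k \<le> \<delta>)" by blast
    let ?x = "(of_int k / 4) *\<^sub>R axis 3 1 :: real^3"
    have x: "4 * ?x $ 3 = of_int k" by (simp add: axis_def)
    show "\<exists>x. on_short_loop g (sqrt (C - D)) x \<and> P (neighbour_within g (sqrt (C - D)) \<delta> x)"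
      using plane_short_loop[of ?x] neighbour_iff[OF D x, of \<delta>] x k
      by (intro exI[of _ ?x]) (simp add: m_def)
  qed
  define N where "N a = normalizer C D * (1 / 4 + a / (2 * pi))" for a
  have cmp: "N a \<le> N b \<longleftrightarrow> a \<le> b" for a b
    unfolding N_def using normalizer_pos by (simp add: divide_le_cancel)
  have lo: "?lo = N (- (\<alpha> + \<beta>))" and hi: "?hi = N (\<beta> - \<alpha>)"
    unfolding N_def by (simp_all only: minus_divide_left[symmetric] diff_conv_add_uminus)
  have gaps: "gap (4 * q) = N (\<alpha> + \<beta>)" "gap (4 * q + 1) = N (\<beta> - \<alpha>)"
     "gap (4 * q + 2) = N (- (\<alpha> + \<beta>))" "gap (4 * q + 3) = N (\<alpha> - \<beta>)" for q
    unfolding lo[symmetric] gap_values by (simp_all only: N_def)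
  have "4 * q - 1 = 4 * (q - 1) + 3" "4 * q + 2 - 1 = 4 * q + 1" "4 * q + 3 - 1 = 4 * q + 2" for q :: int
    by simp_all
  then have m_eq: "m (4 * q) = min (N (\<alpha> + \<beta>)) (N (\<alpha> - \<beta>))"
      "m (4 * q + 1) = min (N (\<beta> - \<alpha>)) (N (\<alpha> + \<beta>))"
      "m (4 * q + 2) = min (N (- (\<alpha> + \<beta>))) (N (\<beta> - \<alpha>))"
      "m (4 * q + 3) = min (N (\<alpha> - \<beta>)) (N (- (\<alpha> + \<beta>)))" for q
    unfolding m_def by (simp_all only: gaps add_diff_cancel_right')
  have m: "m (4 * q + 1) = ?hi" "m (4 * q + 2) = ?lo" for q
    unfolding m_eq lo hi using ab by (simp_all add: min_def cmp)
  have m_bounds: "?lo \<le> m k" "m k \<le> ?hi" for k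
    unfolding lo hi using ab
    by (cases k rule: gap_mod4_cases; simp add: m_eq min_le_iff_disj cmp)+
  have "(\<exists>k. m k \<le> \<delta>) \<longleftrightarrow> ?lo \<le> \<delta>" using m(2)[of 0] m_bounds(1) order_trans by metis
  then show "(\<exists>x. on_short_loop g (sqrt (C - D)) x \<and> neighbour_within g (sqrt (C - D)) \<delta> x) \<longleftrightarrow> ?lo \<le> \<delta>"
    using ex[of "\<lambda>b. b"] by simp
  have "(\<exists>k. \<not> m k \<le> \<delta>) \<longleftrightarrow> \<delta> < ?hi" using m(1)[of 0] m_bounds(2) by (metis not_le order_less_le_trans)
  then show "(\<exists>x. on_short_loop g (sqrt (C - D)) x \<and> \<not> neighbour_within g (sqrt (C - D)) \<delta> x) \<longleftrightarrow> \<delta> < ?hi"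
    using ex[of "\<lambda>b. \<not> b"] by simp
qed

end

lemma isometric_screw_eq:
  assumes "screw C D \<alpha> \<beta>" "screw C D \<alpha>' \<beta>'" "D > 0" "0 < \<alpha>" "\<alpha> < \<beta>" "0 < \<alpha>'" "\<alpha>' < \<beta>'"
    and iso: "isometric (screw_metric C D \<alpha> \<beta>) (screw_metric C D \<alpha>' \<beta>')"
  shows "\<alpha> = \<alpha>' \<and> \<beta> = \<beta>'"
proof -
  let ?N = "normalizer C D"
  have N: "?N > 0" by (rule screw.normalizer_pos[OF assms(1)])
  have "?N * (1 / 4 - (\<alpha> + \<beta>) / (2 * pi)) \<le> \<delta> \<longleftrightarrow> ?N * (1 / 4 - (\<alpha>' + \<beta>') / (2 * pi)) \<le> \<delta>" for \<delta>
    using isometric_neighbour_invariant(1)[OF iso, of "sqrt (C - D)" \<delta>]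
      screw.invariants(1)[OF assms(1,3,4,5)] screw.invariants(1)[OF assms(2,3,6,7)] by simp
  then have "?N * (1 / 4 - (\<alpha> + \<beta>) / (2 * pi)) = ?N * (1 / 4 - (\<alpha>' + \<beta>') / (2 * pi))"
    by (meson order_antisym order_refl)
  then have 1: "\<alpha> + \<beta> = \<alpha>' + \<beta>'" using N by simp
  have "\<delta> < ?N * (1 / 4 + (\<beta> - \<alpha>) / (2 * pi)) \<longleftrightarrow> \<delta> < ?N * (1 / 4 + (\<beta>' - \<alpha>') / (2 * pi))" for \<delta>
    using isometric_neighbour_invariant(2)[OF iso, of "sqrt (C - D)" \<delta>]
      screw.invariants(2)[OF assms(1,3,4,5)] screw.invariants(2)[OF assms(2,3,6,7)] by simp
  then have "?N * (1 / 4 + (\<beta> - \<alpha>) / (2 * pi)) = ?N * (1 / 4 + (\<beta>' - \<alpha>') / (2 * pi))"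
    by (meson linorder_neqE less_irrefl)
  then have 2: "\<beta> - \<alpha> = \<beta>' - \<alpha>'" using N by simp
  from 1 2 show ?thesis by auto
qed

section \<open>The two-parameter family\<close>

lemma screw_unit: "screw 1 0 0 0" by unfold_locales auto

lemma stable_norm_flat: "stable_norm flat_metric (r_class a b c) = ereal (sqrt (a\<^sup>2 + b\<^sup>2 + c\<^sup>2))"
  using screw.stable_norm_screw[OF screw_unit] unfolding screw_flat .

text \<open>
  The values \<open>5/4\<close> and \<open>3/4\<close> satisfy \<open>C\<^sup>2 - D\<^sup>2 = 1\<close>. The two coefficients are injective functions of \<open>l\<close> and
  \<open>s\<close> that lie in \<open>(0, 1/4)\<close> and \<open>[1/3, 2/3)\<close>, so that \<open>\<alpha> < \<beta>\<close> and \<open>\<alpha> + \<beta> < 1\<close> hold throughout.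
\<close>
definition family :: "real \<Rightarrow> real \<Rightarrow> real^3 \<Rightarrow> real^3^3" where
  "family l s = screw_metric (5/4) (3/4) (1 / (4 * l)) ((1 + s) / 3)"

lemma family_parameters:
  assumes "1 < l" "0 \<le> s" "s < 1"
  shows "screw (5/4) (3/4) (1 / (4 * l)) ((1 + s) / 3)"
    and "0 < 1 / (4 * l)" "1 / (4 * l) < (1 + s) / 3"
proof -
  have "1 / (4 * l) < 1 / 4" "0 < 1 / (4 * l)"
    using assms by (simp_all add: divide_strict_left_mono)
  have "1 / 4 < (1 + s) / 3" "(1 + s) / 3 < 2 / 3" using assms by simp_all
  from \<open>1 / (4 * l) < 1 / 4\<close> \<open>0 < 1 / (4 * l)\<close> \<open>1 / 4 < (1 + s) / 3\<close>
  show "0 < 1 / (4 * l)" "1 / (4 * l) < (1 + s) / 3" by linarith+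
  show "screw (5/4) (3/4) (1 / (4 * l)) ((1 + s) / 3)"
  proof
    show "\<bar>1 / (4 * l)\<bar> + \<bar>(1 + s) / 3\<bar> < 1"
      using \<open>1 / (4 * l) < 1 / 4\<close> \<open>0 < 1 / (4 * l)\<close> \<open>1 / 4 < (1 + s) / 3\<close> \<open>(1 + s) / 3 < 2 / 3\<close>
      by linarith
  qed (simp_all add: power2_eq_square)
qed

lemma family_smooth:
  "smooth_on {(l, s, x). 1 < l \<and> 0 \<le> s \<and> s < 1} (\<lambda>(l, s, x). family l s x)"
  unfolding smooth_on_def
proof
  fix p :: "real \<times> real \<times> (real^3)"
  assume "p \<in> {(l, s, x). 1 < l \<and> 0 \<le> s \<and> s < 1}"
  then have p: "0 < fst p" by auto
  let ?U = "{p :: real \<times> real \<times> (real^3). 0 < fst p}"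
  have U: "open ?U" by (intro open_Collect_less continuous_intros)
  have l: "elementary ?U fst" by (intro el_linear bounded_linear_fst)
  have s: "elementary ?U (\<lambda>p. fst (snd p))"
    by (intro el_linear bounded_linear_compose[OF bounded_linear_fst bounded_linear_snd])
  have t: "elementary ?U (\<lambda>p. snd (snd p) $ 3)"
    by (intro el_linear bounded_linear_compose[OF bounded_linear_vec_nth]
        bounded_linear_compose[OF bounded_linear_snd bounded_linear_snd])
  have "smooth_on_open ?U (\<lambda>p. screw_matrix (5/4) (3/4) (1 / (4 * fst p)) ((1 + fst (snd p)) / 3) (snd (snd p) $ 3))"
    by (intro smooth_screw_matrix U t el_divide el_mult el_add el_const l s) auto
  then have "smooth_on_open ?U (\<lambda>(l, s, x). family l s x)"
    by (simp add: family_def screw_metric_def case_prod_unfold)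
  then show "\<exists>U F. open U \<and> p \<in> U \<and> smooth_on_open U F \<and>
      (\<forall>q\<in>U \<inter> {(l, s, x). 1 < l \<and> 0 \<le> s \<and> s < 1}. F q = (\<lambda>(l, s, x). family l s x) q)"
    using U p by blast
qed

theorem theorem1p5:
  shows "\<exists>G :: real \<Rightarrow> real \<Rightarrow> real^3 \<Rightarrow> real^3^3.
    smooth_on {(l, s, x). 1 < l \<and> 0 \<le> s \<and> s < 1} (\<lambda>(l, s, x). G l s x) \<and>
    (\<forall>l s. 1 < l \<and> 0 \<le> s \<and> s < 1 \<longrightarrow>
       riemannian_metric (G l s) \<and> \<not> is_flat (G l s) \<and>
       (\<forall>a b c. stable_norm (G l s) (r_class a b c) = ereal (sqrt (a\<^sup>2 + b\<^sup>2 + c\<^sup>2)) \<and>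
                stable_norm (G l s) (r_class a b c) = stable_norm flat_metric (r_class a b c))) \<and>
    (\<forall>l s l' s'. 1 < l \<and> 0 \<le> s \<and> s < 1 \<and> 1 < l' \<and> 0 \<le> s' \<and> s' < 1 \<and> (l, s) \<noteq> (l', s') \<longrightarrow>
       \<not> isometric (G l s) (G l' s'))"
proof (rule exI[of _ family], intro conjI allI impI family_smooth)
  fix l s :: real assume ls: "1 < l \<and> 0 \<le> s \<and> s < 1"
  then interpret screw "5/4" "3/4" "1 / (4 * l)" "(1 + s) / 3" by (intro family_parameters) auto
  show "riemannian_metric (family l s)" unfolding family_def by (rule riemannian)
  show "\<not> is_flat (family l s)" unfolding family_def by (rule not_flat) simp
  fix a b c
  show "stable_norm (family l s) (r_class a b c) = ereal (sqrt (a\<^sup>2 + b\<^sup>2 + c\<^sup>2))"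
    unfolding family_def by (rule stable_norm_screw)
  then show "stable_norm (family l s) (r_class a b c) = stable_norm flat_metric (r_class a b c)"
    by (simp only: stable_norm_flat)
next
  fix l s l' s' :: real
  assume ls: "1 < l \<and> 0 \<le> s \<and> s < 1 \<and> 1 < l' \<and> 0 \<le> s' \<and> s' < 1 \<and> (l, s) \<noteq> (l', s')"
  show "\<not> isometric (family l s) (family l' s')"
  proof
    assume "isometric (family l s) (family l' s')"
    then have "1 / (4 * l) = 1 / (4 * l') \<and> (1 + s) / 3 = (1 + s') / 3"
      unfolding family_def using ls family_parameters
      by (intro isometric_screw_eq[of "5/4" "3/4"]) auto
    then show False using ls by (auto simp: field_simps)
  qed
qed

end
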